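(* For every $m\in\mathbb{N}$: (a) $E(m,1)=\left\lfloor\frac{2(m+1)}{3}\right\rfloor$; (b) $E(m,2)=\left\lfloor\frac{2(m+2)}{3}\right\rfloor$; (c) $E(m,3)=\left\lfloor\frac{2(m+3)}{3}\right\rfloor$.
   Context: $G(m,n)$ is the grid graph on $[m]\times[n]$ with edges between vertices at Euclidean distance 1. In 2-neighbour bootstrap percolation, a vertex becomes infected once at least 2 of its neighbours are infected, infected vertices stay infected; an initial set percolates if eventually all vertices are infected. A minimal percolating set is a percolating set none of whose proper subsets percolates. $E(m,n)$ is the maximum size of a minimal percolating set of $G(m,n)$. *)

theory Defs
  imports "HOL-Analysis.Analysis"
begin

definition grid_verts :: "nat \<Rightarrow> nat \<Rightarrow> (nat \<times> nat) set" where
  "grid_verts m n = {1..m} \<times> {1..n}"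

text \<open>The distance on \<^typ>\<open>real \<times> real\<close> is the Euclidean one.\<close>

definition grid_adj :: "nat \<Rightarrow> nat \<Rightarrow> nat \<times> nat \<Rightarrow> nat \<times> nat \<Rightarrow> bool" where
  "grid_adj m n u v \<longleftrightarrow> u \<in> grid_verts m n \<and> v \<in> grid_verts m n \<and>
     dist (real (fst u), real (snd u)) (real (fst v), real (snd v)) = 1"

primrec infected :: "nat \<Rightarrow> nat \<Rightarrow> (nat \<times> nat) set \<Rightarrow> nat \<Rightarrow> (nat \<times> nat) set" where
  "infected m n A 0 = A"
| "infected m n A (Suc t) = infected m n A t \<union>
     {v \<in> grid_verts m n. card {u \<in> infected m n A t. grid_adj m n u v} \<ge> 2}"

definition percolates :: "nat \<Rightarrow> nat \<Rightarrow> (nat \<times> nat) set \<Rightarrow> bool" where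
  "percolates m n A \<longleftrightarrow> A \<subseteq> grid_verts m n \<and> (\<exists>t. infected m n A t = grid_verts m n)"

definition minimal_percolating :: "nat \<Rightarrow> nat \<Rightarrow> (nat \<times> nat) set \<Rightarrow> bool" where
  "minimal_percolating m n A \<longleftrightarrow> percolates m n A \<and> (\<forall>B. B \<subset> A \<longrightarrow> \<not> percolates m n B)"

definition max_minimal_percolating :: "nat \<Rightarrow> nat \<Rightarrow> nat" where
  "max_minimal_percolating m n = Max {card A | A. minimal_percolating m n A}"

text \<open>The following two facts show that the maximum is taken over a finite nonempty set.\<close>

lemma finite_minimal_percolating_cards:
  "finite {card A | A. minimal_percolating m n A}"
proof -
  have "{card A | A. minimal_percolating m n A} \<subseteq> card ` Pow (grid_verts m n)"
    by (auto simp: minimal_percolating_def percolates_def)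
  then show ?thesis
    by (rule finite_subset) (simp add: grid_verts_def)
qed

lemma minimal_percolating_cards_nonempty:
  "{card A | A. minimal_percolating m n A} \<noteq> {}"
proof -
  let ?P = "{A. percolates m n A}"
  have "finite ?P"
    by (rule finite_subset[of _ "Pow (grid_verts m n)"])
       (auto simp: percolates_def grid_verts_def)
  moreover have "infected m n (grid_verts m n) 0 = grid_verts m n"
    by simp
  then have "percolates m n (grid_verts m n)"
    unfolding percolates_def by blast
  then have "?P \<noteq> {}"
    by blast
  ultimately obtain A where "A \<in> ?P" "\<forall>B\<in>?P. B \<subseteq> A \<longrightarrow> A = B"
    using finite_has_minimal[of ?P] by blast
  then have "minimal_percolating m n A"
    by (auto simp: minimal_percolating_def)
  then show ?thesis
    by blast
qed

end

theory Submission
  imports Defs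
begin

text \<open>A set that percolates has no two consecutive empty columns (counting the columns just outside
  the grid as empty), and conversely such a set percolates as soon as its closure contains a full
  column. What makes a full column appear is a \<open>seed\<close>: nothing for one row; two cells in equal or
  adjacent columns for two rows; for three rows, two opposite cells of the outer rows, or a two-row
  seed whose growth inside two rows comes close to a cell, or to another growing seed, of the
  third row. In a minimal set a column outside the seed holds at most one cell, and it cannot have
  both neighbours occupied, because deleting it would still leave a percolating set.

  Let \<open>q\<close> be the number of occupied columns, \<open>w\<close> the number of those with both neighbours occupied
  and \<open>i\<close> the number of those with none. Counting maximal runs gives \<open>3 q \<le> 2 m + 2 + w - i\<close>. With
  \<open>d\<close> columns holding two cells, the seeds satisfy \<open>w - i + 3 d \<le> 2 (n - 1)\<close>, because a seed in two
  columns contributes at most 2 to \<open>w\<close>, while a two-row seed in a single column is isolated (else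
  one of its cells could be dropped), unless for three rows it is next to a cell of the third row.
  Hence \<open>3 |A| \<le> 2 (m + n)\<close>. Equality up to rounding is attained by a seed in the first three
  columns followed by the column pattern empty, occupied, occupied, repeated.\<close>

definition lattice_adj :: "int \<times> int \<Rightarrow> int \<times> int \<Rightarrow> bool" where
  "lattice_adj u v \<longleftrightarrow> \<bar>fst u - fst v\<bar> + \<bar>snd u - snd v\<bar> = 1"

definition closed_in :: "(int \<times> int) set \<Rightarrow> (int \<times> int) set \<Rightarrow> bool" where
  "closed_in R C \<longleftrightarrow> C \<subseteq> R \<and>
     (\<forall>v\<in>R. \<forall>u\<in>C. \<forall>w\<in>C. u \<noteq> w \<longrightarrow> lattice_adj u v \<longrightarrow> lattice_adj w v \<longrightarrow> v \<in> C)"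

definition spans :: "(int \<times> int) set \<Rightarrow> (int \<times> int) set \<Rightarrow> bool" where
  "spans R A \<longleftrightarrow> A \<subseteq> R \<and> (\<forall>C. closed_in R C \<longrightarrow> A \<subseteq> C \<longrightarrow> C = R)"

definition min_spans :: "(int \<times> int) set \<Rightarrow> (int \<times> int) set \<Rightarrow> bool" where
  "min_spans R A \<longleftrightarrow> spans R A \<and> (\<forall>B. B \<subset> A \<longrightarrow> \<not> spans R B)"

definition strip :: "int \<Rightarrow> int set \<Rightarrow> (int \<times> int) set" where
  "strip m H = {1..m} \<times> H"

subsection \<open>Percolation as a closure condition\<close>

lemma grid_adj_iff:
  "grid_adj m n (a, b) (c, d) \<longleftrightarrow> (a, b) \<in> grid_verts m n \<and> (c, d) \<in> grid_verts m n \<and>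
     \<bar>int a - int c\<bar> + \<bar>int b - int d\<bar> = 1"
proof -
  have sq: "x\<^sup>2 + y\<^sup>2 = 1 \<longleftrightarrow> \<bar>x\<bar> + \<bar>y\<bar> = 1" for x y :: int
  proof
    assume h: "x\<^sup>2 + y\<^sup>2 = 1"
    then have "x\<^sup>2 \<le> 1" "y\<^sup>2 \<le> 1"
      using zero_le_power2[of x] zero_le_power2[of y] by linarith+
    then have "\<bar>x\<bar> \<le> 1" "\<bar>y\<bar> \<le> 1"
      by (simp_all add: abs_square_le_1)
    then have "x \<in> {-1, 0, 1}" "y \<in> {-1, 0, 1}"
      by auto
    then show "\<bar>x\<bar> + \<bar>y\<bar> = 1"
      using h by auto
  next
    assume h: "\<bar>x\<bar> + \<bar>y\<bar> = 1"
    then have "x \<in> {-1, 0, 1}" "y \<in> {-1, 0, 1}"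
      by auto
    then show "x\<^sup>2 + y\<^sup>2 = 1"
      using h by auto
  qed
  have "dist (real a, real b) (real c, real d) = 1 \<longleftrightarrow>
      (real a - real c)\<^sup>2 + (real b - real d)\<^sup>2 = 1"
    by (simp add: dist_Pair_Pair dist_real_def)
  also have "\<dots> \<longleftrightarrow> real_of_int ((int a - int c)\<^sup>2 + (int b - int d)\<^sup>2) = real_of_int 1"
    by simp
  also have "\<dots> \<longleftrightarrow> (int a - int c)\<^sup>2 + (int b - int d)\<^sup>2 = 1"
    by (rule of_int_eq_iff)
  finally show ?thesis
    by (simp add: grid_adj_def sq)
qed

lemma infected_mono: "t \<le> t' \<Longrightarrow> infected m n A t \<subseteq> infected m n A t'"
  by (rule lift_Suc_mono_le[of "infected m n A"]) auto

lemma infected_subset_grid: "A \<subseteq> grid_verts m n \<Longrightarrow> infected m n A t \<subseteq> grid_verts m n"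
  by (induction t) auto

lemma percolates_iff_spans:
  fixes c :: int
  defines "f \<equiv> \<lambda>(x, s). (int x, int s - c)"
  assumes A: "A \<subseteq> grid_verts m n"
  shows "percolates m n A \<longleftrightarrow> spans (f ` grid_verts m n) (f ` A)"
proof -
  let ?G = "grid_verts m n" and ?I = "infected m n A"
  have injf: "inj f"
    by (auto simp: f_def inj_def)
  have adj: "grid_adj m n u v \<longleftrightarrow> u \<in> ?G \<and> v \<in> ?G \<and> lattice_adj (f u) (f v)" for u v
    by (cases u; cases v) (simp add: grid_adj_iff lattice_adj_def f_def)
  have fin: "finite ?G"
    by (simp add: grid_verts_def)
  have IG: "?I t \<subseteq> ?G" for t
    using infected_subset_grid[OF A] .
  show ?thesis
  proof
    assume "percolates m n A"
    then obtain t where t: "?I t = ?G"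
      by (auto simp: percolates_def)
    show "spans (f ` ?G) (f ` A)"
      unfolding spans_def
    proof (intro conjI allI impI)
      show "f ` A \<subseteq> f ` ?G"
        using A by blast
      fix C assume C: "closed_in (f ` ?G) C" "f ` A \<subseteq> C"
      have "f ` ?I t \<subseteq> C" for t
      proof (induction t)
        case 0
        then show ?case using C by simp
      next
        case (Suc t)
        have "f v \<in> C" if v: "v \<in> ?G" "card {u \<in> ?I t. grid_adj m n u v} \<ge> 2" for v
        proof -
          let ?S = "{u \<in> ?I t. grid_adj m n u v}"
          have "finite ?S"
            using finite_subset[OF IG fin] by simp
          then have "\<not> (\<forall>u\<in>?S. \<forall>w\<in>?S. u = w)"
            using v(2) card_le_Suc0_iff_eq[of ?S] by simp
          then obtain u w where uw: "u \<in> ?S" "w \<in> ?S" "u \<noteq> w"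
            by blast
          then have "f u \<in> C" "f w \<in> C" "f u \<noteq> f w" "lattice_adj (f u) (f v)" "lattice_adj (f w) (f v)"
            using Suc injf by (auto simp: adj inj_eq)
          then show ?thesis
            using C(1) v(1) unfolding closed_in_def by blast
        qed
        then show ?case
          using Suc by auto
      qed
      from this[of t] show "C = f ` ?G"
        using t C(1) unfolding closed_in_def by auto
    qed
  next
    assume sp: "spans (f ` ?G) (f ` A)"
    let ?U = "\<Union>t. ?I t"
    have "closed_in (f ` ?G) (f ` ?U)"
      unfolding closed_in_def
    proof (intro conjI ballI impI)
      show "f ` ?U \<subseteq> f ` ?G"
        using IG by blast
      fix v' u' w' assume h: "v' \<in> f ` ?G" "u' \<in> f ` ?U" "w' \<in> f ` ?U" "u' \<noteq> w'"
        "lattice_adj u' v'" "lattice_adj w' v'"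
      then obtain v u w t1 t2 where v: "v' = f v" "v \<in> ?G" and u: "u' = f u" "u \<in> ?I t1"
        and w: "w' = f w" "w \<in> ?I t2"
        by blast
      define t where "t = max t1 t2"
      have ut: "u \<in> ?I t" "w \<in> ?I t"
        using u w infected_mono[of t1 t m n A] infected_mono[of t2 t m n A] by (auto simp: t_def)
      let ?S = "{u \<in> ?I t. grid_adj m n u v}"
      have "{u, w} \<subseteq> ?S"
        using ut IG[of t] v u w h by (auto simp: adj)
      moreover have "finite ?S"
        using finite_subset[OF IG fin] by simp
      ultimately have "card {u, w} \<le> card ?S"
        by (rule card_mono[rotated])
      moreover have "u \<noteq> w"
        using h(4) u w by blast
      then have "card {u, w} = 2"
        by simp
      ultimately have "v \<in> ?I (Suc t)"
        using v by simp
      then show "v' \<in> f ` ?U"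
        using v by blast
    qed
    moreover have "f ` A \<subseteq> f ` ?U"
      using infected.simps(1)[of m n A] by blast
    ultimately have "f ` ?U = f ` ?G"
      using sp by (simp add: spans_def)
    then have U: "?U = ?G"
      using injf by (simp add: inj_image_eq_iff)
    have "\<exists>t. S \<subseteq> ?I t" if "finite S" "S \<subseteq> ?U" for S
      using that
    proof (induction S)
      case (insert v S)
      then obtain t1 t2 where "S \<subseteq> ?I t1" "v \<in> ?I t2"
        by auto
      then have "insert v S \<subseteq> ?I (max t1 t2)"
        using infected_mono[of t1 "max t1 t2" m n A] infected_mono[of t2 "max t1 t2" m n A] by auto
      then show ?case ..
    qed simp
    from this[of ?G] fin U obtain t where "?G \<subseteq> ?I t"
      by blast
    then show "percolates m n A"
      using A IG[of t] by (auto simp: percolates_def)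
  qed
qed

lemma minimal_percolating_iff_min_spans:
  fixes c :: int
  defines "f \<equiv> \<lambda>(x, s). (int x, int s - c)"
  assumes A: "A \<subseteq> grid_verts m n"
  shows "minimal_percolating m n A \<longleftrightarrow> min_spans (f ` grid_verts m n) (f ` A)"
proof -
  have injf: "inj f"
    by (auto simp: f_def inj_def)
  note iff = percolates_iff_spans[where c = c, folded f_def]
  have sub: "(\<exists>B. B \<subset> A \<and> percolates m n B) \<longleftrightarrow>
      (\<exists>B'. B' \<subset> f ` A \<and> spans (f ` grid_verts m n) B')"
  proof (intro iffI; elim exE conjE)
    fix B assume "B \<subset> A" "percolates m n B"
    then have "f ` B \<subset> f ` A" "spans (f ` grid_verts m n) (f ` B)"
      using iff[of B m n] A inj_image_eq_iff[OF injf, of B A] by (blast, metis order.trans psubset_imp_subset)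
    then show "\<exists>B'. B' \<subset> f ` A \<and> spans (f ` grid_verts m n) B'"
      by blast
  next
    fix B' assume h: "B' \<subset> f ` A" "spans (f ` grid_verts m n) B'"
    then obtain B where B: "B \<subseteq> A" "B' = f ` B"
      by (metis psubset_imp_subset subset_image_iff)
    then have "B \<subset> A"
      using h(1) by auto
    then show "\<exists>B. B \<subset> A \<and> percolates m n B"
      using iff[of B m n] B A h(2) by auto
  qed
  show ?thesis
    unfolding minimal_percolating_def min_spans_def using sub iff[OF A] by blast
qed

lemma shifted_grid:
  "(\<lambda>(x, s). (int x, int s - c)) ` grid_verts m n = strip (int m) {1 - c..int n - c}"
proof -
  have "(x, s) \<in> (\<lambda>(x, s). (int x, int s - c)) ` grid_verts m n"
    if "1 \<le> x" "x \<le> int m" "1 \<le> s + c" "s + c \<le> int n" for x s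
    by (rule image_eqI[of _ _ "(nat x, nat (s + c))"]) (use that in \<open>auto simp: grid_verts_def\<close>)
  then show ?thesis
    by (auto simp: grid_verts_def strip_def)
qed

lemma max_minimal_percolating_eqI:
  fixes m n k :: nat and c :: int
  assumes upper: "\<And>B. min_spans (strip (int m) {1 - c..int n - c}) B \<Longrightarrow> card B \<le> k"
    and lower: "\<exists>B. min_spans (strip (int m) {1 - c..int n - c}) B \<and> card B = k"
  shows "max_minimal_percolating m n = k"
proof -
  define f where "f = (\<lambda>(x :: nat, s :: nat). (int x, int s - c))"
  have injf: "inj f"
    by (auto simp: f_def inj_def)
  note iff = minimal_percolating_iff_min_spans[where c = c, unfolded shifted_grid, folded f_def]
  have img: "f ` grid_verts m n = strip (int m) {1 - c..int n - c}"
    by (simp add: f_def shifted_grid)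
  have "card A \<le> k" if "minimal_percolating m n A" for A
  proof -
    have "A \<subseteq> grid_verts m n"
      using that by (simp add: minimal_percolating_def percolates_def)
    then have "card (f ` A) \<le> k"
      using that iff upper by blast
    then show ?thesis
      using card_image[OF inj_on_subset[OF injf]] by simp
  qed
  moreover have "\<exists>A. minimal_percolating m n A \<and> card A = k"
  proof -
    obtain B where B: "min_spans (strip (int m) {1 - c..int n - c}) B" "card B = k"
      using lower by blast
    then have "B \<subseteq> f ` grid_verts m n"
      by (simp add: img min_spans_def spans_def)
    then obtain A where A: "A \<subseteq> grid_verts m n" "B = f ` A"
      by (auto simp: subset_image_iff)
    then show ?thesis
      using B iff[OF A(1)] card_image[OF inj_on_subset[OF injf], of A] by auto
  qed
  ultimately show ?thesis
    unfolding max_minimal_percolating_def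
    by (intro Max_eqI finite_minimal_percolating_cards) auto
qed

subsection \<open>Closed sets in a strip\<close>

lemma closed_inI:
  assumes sub: "C \<subseteq> R"
    and hor: "\<And>x s. (x, s) \<in> R \<Longrightarrow> (x - 1, s) \<in> C \<Longrightarrow> (x + 1, s) \<in> C \<Longrightarrow> (x, s) \<in> C"
    and ver: "\<And>x s. (x, s) \<in> R \<Longrightarrow> (x, s - 1) \<in> C \<Longrightarrow> (x, s + 1) \<in> C \<Longrightarrow> (x, s) \<in> C"
    and cor: "\<And>x s y r. (x, s) \<in> R \<Longrightarrow> (y, s) \<in> C \<Longrightarrow> (x, r) \<in> C \<Longrightarrow>
        \<bar>x - y\<bar> = 1 \<Longrightarrow> \<bar>s - r\<bar> = 1 \<Longrightarrow> (x, s) \<in> C"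
  shows "closed_in R C"
  unfolding closed_in_def
proof (intro conjI ballI impI)
  fix v u w assume h: "v \<in> R" "u \<in> C" "w \<in> C" "u \<noteq> w" "lattice_adj u v" "lattice_adj w v"
  obtain x s where v: "v = (x, s)" by force
  have nb: "(\<exists>y. u = (y, s) \<and> \<bar>x - y\<bar> = 1) \<or> (\<exists>r. u = (x, r) \<and> \<bar>s - r\<bar> = 1)"
    if "lattice_adj u v" for u
    using that by (cases u) (auto simp: v lattice_adj_def)
  have one: "z = a - 1 \<or> z = a + 1" if "\<bar>a - z\<bar> = 1" for a z :: int
    using that by linarith
  show "v \<in> C"
    using nb[OF h(5)] nb[OF h(6)]
  proof (elim disjE exE conjE)
    fix y y' assume "u = (y, s)" "\<bar>x - y\<bar> = 1" "w = (y', s)" "\<bar>x - y'\<bar> = 1"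
    then show ?thesis using one[of x y] one[of x y'] hor[of x s] h v by auto
  next
    fix r r' assume "u = (x, r)" "\<bar>s - r\<bar> = 1" "w = (x, r')" "\<bar>s - r'\<bar> = 1"
    then show ?thesis using one[of s r] one[of s r'] ver[of x s] h v by auto
  next
    fix y r assume "u = (y, s)" "\<bar>x - y\<bar> = 1" "w = (x, r)" "\<bar>s - r\<bar> = 1"
    then show ?thesis using cor[of x s y r] h v by auto
  next
    fix y r assume "u = (x, r)" "\<bar>s - r\<bar> = 1" "w = (y, s)" "\<bar>x - y\<bar> = 1"
    then show ?thesis using cor[of x s y r] h v by auto
  qed
qed (rule sub)

lemma closed_in_hor:
  assumes "closed_in R C" "(x, s) \<in> R" "(y, s) \<in> C" "(z, s) \<in> C" "\<bar>x - y\<bar> = 1" "\<bar>x - z\<bar> = 1" "y \<noteq> z"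
  shows "(x, s) \<in> C"
proof -
  have "lattice_adj (y, s) (x, s)" "lattice_adj (z, s) (x, s)" "(y, s) \<noteq> (z, s)"
    using assms by (auto simp: lattice_adj_def)
  then show ?thesis
    using assms(1-4) unfolding closed_in_def by blast
qed

lemma closed_in_ver:
  assumes "closed_in R C" "(x, s) \<in> R" "(x, s - 1) \<in> C" "(x, s + 1) \<in> C"
  shows "(x, s) \<in> C"
proof -
  have "lattice_adj (x, s - 1) (x, s)" "lattice_adj (x, s + 1) (x, s)" "(x, s - 1) \<noteq> (x, s + 1)"
    by (auto simp: lattice_adj_def)
  then show ?thesis
    using assms unfolding closed_in_def by blast
qed

lemma closed_in_corner:
  assumes "closed_in R C" "(x, s) \<in> R" "(y, s) \<in> C" "(x, r) \<in> C" "\<bar>x - y\<bar> = 1" "\<bar>s - r\<bar> = 1"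
  shows "(x, s) \<in> C"
proof -
  have "lattice_adj (y, s) (x, s)" "lattice_adj (x, r) (x, s)" "(y, s) \<noteq> (x, r)"
    using assms by (auto simp: lattice_adj_def)
  then show ?thesis
    using assms(1-4) unfolding closed_in_def by blast
qed

definition occ :: "(int \<times> int) set \<Rightarrow> int set" where
  "occ A = fst ` A"

definition dense_cols :: "int \<Rightarrow> (int \<times> int) set \<Rightarrow> bool" where
  "dense_cols m A \<longleftrightarrow> (\<forall>x. 0 \<le> x \<longrightarrow> x \<le> m \<longrightarrow> x \<in> occ A \<or> x + 1 \<in> occ A)"

lemma occ_iff: "x \<in> occ A \<longleftrightarrow> (\<exists>s. (x, s) \<in> A)"
  by (force simp: occ_def)

lemma spans_dense_cols:
  assumes sp: "spans (strip m H) A" and m: "m \<ge> 1" and H: "H \<noteq> {}"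
  shows "dense_cols m A"
  unfolding dense_cols_def
proof (intro allI impI, rule ccontr)
  fix x assume x: "0 \<le> x" "x \<le> m" "\<not> (x \<in> occ A \<or> x + 1 \<in> occ A)"
  let ?C = "{v \<in> strip m H. fst v \<noteq> x \<and> fst v \<noteq> x + 1}"
  have "closed_in (strip m H) ?C"
    by (rule closed_inI) auto
  moreover have "A \<subseteq> ?C"
    using sp x by (auto simp: spans_def occ_iff)
  ultimately have C: "?C = strip m H"
    using sp by (simp add: spans_def)
  obtain s where "s \<in> H"
    using H by blast
  then have "(x, s) \<in> strip m H \<or> (x + 1, s) \<in> strip m H"
    using x m by (auto simp: strip_def)
  moreover have "v \<in> ?C" if "v \<in> strip m H" for v
    using that unfolding C .
  ultimately show False
    by fastforce
qed

lemma spans_extreme_row: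
  assumes sp: "spans (strip m H) A" and m: "m \<ge> 1"
    and r: "r \<in> H" "r - 1 \<notin> H \<or> r + 1 \<notin> H"
  shows "\<exists>x. (x, r) \<in> A"
proof (rule ccontr)
  assume n: "\<nexists>x. (x, r) \<in> A"
  let ?C = "{v \<in> strip m H. snd v \<noteq> r}"
  have "closed_in (strip m H) ?C"
    by (rule closed_inI) (use r in \<open>auto simp: strip_def\<close>)
  moreover have "A \<subseteq> ?C"
    using sp n by (auto simp: spans_def)
  ultimately have C: "?C = strip m H"
    using sp by (simp add: spans_def)
  have "(1, r) \<in> strip m H"
    using r m by (auto simp: strip_def)
  moreover have "v \<in> ?C" if "v \<in> strip m H" for v
    using that unfolding C .
  ultimately show False
    by fastforce
qed

lemma full_column_step:
  fixes lo hi :: int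
  assumes C: "closed_in (strip m {lo..hi}) C" and AC: "A \<subseteq> C" and d: "dense_cols m A"
    and y: "\<bar>x - y\<bar> = 1" "y \<in> {1..m}" and full: "{x} \<times> {lo..hi} \<subseteq> C"
  shows "{y} \<times> {lo..hi} \<subseteq> C"
proof -
  let ?R = "strip m {lo..hi}"
  have R: "(z, s) \<in> ?R \<longleftrightarrow> z \<in> {1..m} \<and> s \<in> {lo..hi}" for z s
    by (auto simp: strip_def)
  have CR: "C \<subseteq> ?R"
    using C by (simp add: closed_in_def)
  have "\<exists>s. (y, s) \<in> C"
  proof (cases "y \<in> occ A")
    case True
    then show ?thesis using AC by (auto simp: occ_iff)
  next
    case False
    have "2 * y - x \<in> occ A"
    proof (cases "y = x + 1")
      case True
      then show ?thesis
        using d[unfolded dense_cols_def, rule_format, of y] False y by (simp add: add.commute)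
    next
      case False
      with y have "y = x - 1" by linarith
      then show ?thesis
        using d[unfolded dense_cols_def, rule_format, of "y - 1"] \<open>y \<notin> occ A\<close> y by simp
    qed
    then obtain s where s: "(2 * y - x, s) \<in> C"
      using AC by (auto simp: occ_iff)
    then have "s \<in> {lo..hi}"
      using CR R by blast
    then have "(y, s) \<in> C"
      using y full s by (intro closed_in_hor[OF C, of y s x "2 * y - x"]) (auto simp: R)
    then show ?thesis ..
  qed
  then obtain s where s: "(y, s) \<in> C" by blast
  then have sb: "lo \<le> s" "s \<le> hi"
    using CR R by auto
  have st: "(y, r) \<in> C" if "(y, r') \<in> C" "\<bar>r - r'\<bar> = 1" "lo \<le> r" "r \<le> hi" for r r'
    using that y full by (intro closed_in_corner[OF C, of y r x r']) (auto simp: R)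
  have up: "r \<le> hi \<longrightarrow> (y, r) \<in> C" if "s \<le> r" for r
    using that
  proof (induction r rule: int_ge_induct)
    case (step i)
    then show ?case using st[of i "i + 1"] sb by auto
  qed (use s in auto)
  have down: "lo \<le> r \<longrightarrow> (y, r) \<in> C" if "r \<le> s" for r
    using that
  proof (induction r rule: int_le_induct)
    case (step i)
    then show ?case using st[of i "i - 1"] sb by auto
  qed (use s in auto)
  have "(y, r) \<in> C" if "r \<in> {lo..hi}" for r
    using up[of r] down[of r] that by (cases "s \<le> r") auto
  then show ?thesis
    by auto
qed

lemma full_column_spreads:
  fixes lo hi :: int
  assumes C: "closed_in (strip m {lo..hi}) C" and AC: "A \<subseteq> C" and d: "dense_cols m A"
    and x: "x \<in> {1..m}" and full: "{x} \<times> {lo..hi} \<subseteq> C"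
  shows "C = strip m {lo..hi}"
proof -
  have right: "y \<le> m \<longrightarrow> {y} \<times> {lo..hi} \<subseteq> C" if "x \<le> y" for y
    using that
  proof (induction y rule: int_ge_induct)
    case (step i)
    then show ?case using full_column_step[OF C AC d, of i "i + 1"] x by auto
  qed (use full in auto)
  have left: "1 \<le> y \<longrightarrow> {y} \<times> {lo..hi} \<subseteq> C" if "y \<le> x" for y
    using that
  proof (induction y rule: int_le_induct)
    case (step i)
    then show ?case using full_column_step[OF C AC d, of i "i - 1"] x by auto
  qed (use full in auto)
  have "{y} \<times> {lo..hi} \<subseteq> C" if "y \<in> {1..m}" for y
    using right[of y] left[of y] that by (cases "x \<le> y") auto
  then have "strip m {lo..hi} \<subseteq> C"
    unfolding strip_def by blast
  then show ?thesis
    using C by (auto simp: closed_in_def)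
qed

subsection \<open>Counting occupied columns\<close>

text \<open>Decompose the occupied columns into maximal runs; there is at most one run more than there are
  empty columns. A run of length \<open>l \<ge> 2\<close> contains \<open>l - 2\<close> columns with both neighbours occupied, and
  a run of length 1 is an isolated column.\<close>

lemma card_runs_bound:
  fixes Q :: "int set"
  assumes Q: "Q \<subseteq> {1..m}" and m: "m \<ge> 0"
  shows "3 * int (card Q) + int (card {j \<in> Q. j - 1 \<notin> Q \<and> j + 1 \<notin> Q})
    \<le> 2 * m + 2 + int (card {j \<in> Q. j - 1 \<in> Q \<and> j + 1 \<in> Q})"
proof -
  have fin: "finite Q"
    using Q finite_subset by blast
  let ?w = "{j \<in> Q. j - 1 \<in> Q \<and> j + 1 \<in> Q}" and ?i = "{j \<in> Q. j - 1 \<notin> Q \<and> j + 1 \<notin> Q}"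
    and ?a = "{j \<in> Q. j - 1 \<in> Q \<and> j + 1 \<notin> Q}" and ?b = "{j \<in> Q. j - 1 \<notin> Q \<and> j + 1 \<in> Q}"
    and ?st = "{j \<in> Q. j - 1 \<notin> Q}" and ?en = "{j \<in> Q. j + 1 \<notin> Q}"
  have "card Q = card (?en \<union> (?b \<union> ?w))"
    by (rule arg_cong[where f = card]) auto
  also have "\<dots> = card ?en + (card ?b + card ?w)"
    using fin by (subst card_Un_disjoint; (subst card_Un_disjoint)?) auto
  finally have Qc: "card Q = card ?en + card ?b + card ?w"
    by simp
  have "card ?st = card (?i \<union> ?b)"
    by (rule arg_cong[where f = card]) auto
  also have "\<dots> = card ?i + card ?b"
    using fin by (subst card_Un_disjoint) auto
  finally have stc: "card ?st = card ?i + card ?b" .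
  have comp: "int (card ({a..a + m} - Q)) = m + 1 - int (card Q)" if "a \<in> {0, 1}" for a
  proof -
    have "Q \<subseteq> {a..a + m}"
      using that Q by auto
    then have "card ({a..a + m} - Q) = card {a..a + m} - card Q" "card Q \<le> card {a..a + m}"
      using card_Diff_subset[OF fin] card_mono[of "{a..a + m}" Q] by simp_all
    then show ?thesis
      using m by simp
  qed
  have "card ?st = card ((\<lambda>j. j - 1) ` ?st)"
    by (rule card_image[symmetric]) (auto simp: inj_on_def)
  also have "\<dots> \<le> card ({0..0 + m} - Q)"
    by (rule card_mono) (use Q in auto)
  finally have s: "int (card ?st) \<le> m + 1 - int (card Q)"
    using comp[of 0] by simp
  have "card ?en = card ((\<lambda>j. j + 1) ` ?en)"
    by (rule card_image[symmetric]) (auto simp: inj_on_def)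
  also have "\<dots> \<le> card ({1..1 + m} - Q)"
    by (rule card_mono) (use Q in auto)
  finally have "int (card ?en) \<le> m + 1 - int (card Q)"
    using comp[of 1] by simp
  with s Qc stc show ?thesis
    by linarith
qed

text \<open>Columns in \<open>X\<close> may have both neighbours occupied, columns meeting \<open>E\<close> may hold a second
  cell, and columns in \<open>I\<close> are isolated.\<close>

lemma card_strip_bound:
  assumes A: "A \<subseteq> strip m H" and m: "m \<ge> 0"
    and inj: "inj_on fst (A - E)" and E: "finite E"
    and X: "finite X" "\<And>j. j \<in> occ A \<Longrightarrow> j - 1 \<in> occ A \<Longrightarrow> j + 1 \<in> occ A \<Longrightarrow> j \<in> X"
    and I: "\<And>j. j \<in> I \<Longrightarrow> j \<in> occ A \<and> j - 1 \<notin> occ A \<and> j + 1 \<notin> occ A"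
    and k: "card X + 3 * card E \<le> k + card I"
  shows "3 * int (card A) \<le> 2 * m + 2 + int k"
proof -
  have occ: "occ A \<subseteq> {1..m}"
    using A by (auto simp: occ_def strip_def)
  then have fin: "finite (occ A)"
    using finite_subset by blast
  have "card (A - E) = card (fst ` (A - E))"
    by (rule card_image[symmetric]) (rule inj)
  also have "\<dots> \<le> card (occ A)"
    by (rule card_mono[OF fin]) (auto simp: occ_def)
  finally have "card (A - E) \<le> card (occ A)" .
  moreover have "card A \<le> card (A - E) + card E"
    using diff_card_le_card_Diff[OF E, of A] by linarith
  moreover have "card {j \<in> occ A. j - 1 \<in> occ A \<and> j + 1 \<in> occ A} \<le> card X"
    by (rule card_mono) (use X in auto)
  moreover have "card I \<le> card {j \<in> occ A. j - 1 \<notin> occ A \<and> j + 1 \<notin> occ A}"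
    by (rule card_mono) (use I fin in auto)
  ultimately show ?thesis
    using card_runs_bound[OF occ m] k by linarith
qed

lemma inj_on_fstI: "(\<And>x s r. (x, s) \<in> B \<Longrightarrow> (x, r) \<in> B \<Longrightarrow> s = r) \<Longrightarrow> inj_on fst B"
  by (auto simp: inj_on_def)

lemma occ_remove_double:
  assumes "u \<in> A" "v \<in> A" "fst u = fst v" "u \<noteq> v"
  shows "occ (A - {u}) = occ A"
  unfolding occ_def using assms by (auto intro: rev_image_eqI)

lemma dense_cols_remove_double:
  assumes "dense_cols m A" "u \<in> A" "v \<in> A" "fst u = fst v" "u \<noteq> v"
  shows "dense_cols m (A - {u})"
  using assms(1) occ_remove_double[OF assms(2-5)] by (simp add: dense_cols_def)

definition del_col :: "(int \<times> int) set \<Rightarrow> int \<Rightarrow> (int \<times> int) set" where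
  "del_col A j = {v \<in> A. fst v \<noteq> j}"

lemma del_col_psubset: "j \<in> occ A \<Longrightarrow> del_col A j \<subset> A"
  by (auto simp: del_col_def occ_def)

lemma occ_del_col: "occ (del_col A j) = occ A - {j}"
  by (auto simp: del_col_def occ_def)

lemma dense_cols_del_col:
  assumes d: "dense_cols m A" and j: "j - 1 \<in> occ A" "j + 1 \<in> occ A"
  shows "dense_cols m (del_col A j)"
  unfolding dense_cols_def occ_del_col
proof (intro allI impI)
  fix x assume x: "0 \<le> x" "x \<le> m"
  consider "x = j" | "x + 1 = j" | "x \<noteq> j" "x + 1 \<noteq> j"
    by blast
  then show "x \<in> occ A - {j} \<or> x + 1 \<in> occ A - {j}"
    by cases (use d[unfolded dense_cols_def, rule_format, OF x] j in auto)
qed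

subsection \<open>One row\<close>

lemma spans_one_row_iff:
  assumes m: "m \<ge> 1" and A: "A \<subseteq> strip m {0}"
  shows "spans (strip m {0}) A \<longleftrightarrow> dense_cols m A"
proof
  assume "spans (strip m {0}) A"
  then show "dense_cols m A"
    using spans_dense_cols m by blast
next
  assume d: "dense_cols m A"
  have "0 \<notin> occ A"
    using A by (auto simp: occ_iff strip_def)
  then have "1 \<in> occ A"
    using d[unfolded dense_cols_def, rule_format, of 0] m by simp
  then have "(1, 0) \<in> A"
    using A by (auto simp: occ_iff strip_def)
  then show "spans (strip m {0}) A"
    using A full_column_spreads[of m 0 0 _ A 1] d m by (auto simp: spans_def)
qed

lemma min_spans_one_row_bound:
  assumes m: "m \<ge> 1" and min: "min_spans (strip m {0}) A"
  shows "3 * int (card A) \<le> 2 * m + 2"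
proof -
  have A: "A \<subseteq> strip m {0}"
    using min by (simp add: min_spans_def spans_def)
  have d: "dense_cols m A"
    using min spans_one_row_iff[OF m A] by (simp add: min_spans_def)
  have red: "\<not> dense_cols m B" if "B \<subset> A" for B
    using that min spans_one_row_iff[OF m, of B] A by (auto simp: min_spans_def)
  have window: False if "j \<in> occ A" "j - 1 \<in> occ A" "j + 1 \<in> occ A" for j
    using red[OF del_col_psubset[OF that(1)]] dense_cols_del_col[OF d that(2,3)] by blast
  have inj: "inj_on fst (A - {})"
    using A by (auto simp: inj_on_def strip_def)
  have "3 * int (card A) \<le> 2 * m + 2 + int 0"
    by (rule card_strip_bound[OF A _ inj, where X = "{}" and I = "{}"])
       (use m window in auto)
  then show ?thesis
    by simp
qed

subsection \<open>Two rows\<close>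

definition seed :: "int \<Rightarrow> (int \<times> int) set \<Rightarrow> int \<Rightarrow> int \<Rightarrow> bool" where
  "seed \<sigma> A i i' \<longleftrightarrow> (i, \<sigma>) \<in> A \<and> (i', 0) \<in> A \<and> \<bar>i - i'\<bar> \<le> 1"

lemma seed_fills:
  assumes C: "closed_in R C" and AC: "A \<subseteq> C" and s: "seed \<sigma> A i i'" and \<sigma>: "\<bar>\<sigma>\<bar> = 1"
    and R: "\<And>x. x = i \<or> x = i' \<Longrightarrow> (x, 0) \<in> R \<and> (x, \<sigma>) \<in> R"
  shows "(i, 0) \<in> C \<and> (i, \<sigma>) \<in> C \<and> (i', 0) \<in> C \<and> (i', \<sigma>) \<in> C"
proof (cases "i = i'")
  case True
  then show ?thesis using s AC by (auto simp: seed_def)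
next
  case False
  then have "\<bar>i - i'\<bar> = 1" "(i, \<sigma>) \<in> C" "(i', 0) \<in> C"
    using s AC by (auto simp: seed_def)
  moreover from this have "(i, 0) \<in> C"
    using R \<sigma> by (intro closed_in_corner[OF C, of i 0 i' \<sigma>]) auto
  moreover have "(i', \<sigma>) \<in> C"
    using R \<sigma> calculation by (intro closed_in_corner[OF C, of i' \<sigma> i 0]) auto
  ultimately show ?thesis by blast
qed

lemma spans_two_rows_iff:
  assumes m: "m \<ge> 1" and A: "A \<subseteq> strip m {0..1}"
  shows "spans (strip m {0..1}) A \<longleftrightarrow> dense_cols m A \<and> (\<exists>i i'. seed 1 A i i')"
proof
  assume sp: "spans (strip m {0..1}) A"
  show "dense_cols m A \<and> (\<exists>i i'. seed 1 A i i')"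
  proof (intro conjI)
    show "dense_cols m A"
      using spans_dense_cols[OF sp m] by simp
    show "\<exists>i i'. seed 1 A i i'"
    proof (rule ccontr)
      assume no: "\<nexists>i i'. seed 1 A i i'"
      have row: "s = r" if "(x, s) \<in> A" "(y, r) \<in> A" "\<bar>x - y\<bar> \<le> 1" for x y s r
      proof -
        have "s \<in> {0, 1}" "r \<in> {0, 1}"
          using that A by (auto simp: strip_def)
        moreover have "\<not> seed 1 A x y" "\<not> seed 1 A y x"
          using no by blast+
        ultimately show ?thesis
          using that by (auto simp: seed_def abs_minus_commute)
      qed
      let ?C = "(A \<union> {(x, s). (x - 1, s) \<in> A \<and> (x + 1, s) \<in> A}) \<inter> strip m {0..1}"
      have rowC: "s = r" if "(x, s) \<in> ?C" "(x, r) \<in> ?C" for x s r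
        using that row[of x s x r] row[of x s "x - 1" r] row[of "x - 1" s x r] row[of "x - 1" s "x - 1" r]
        by auto
      have "closed_in (strip m {0..1}) ?C"
      proof (rule closed_inI)
        fix x s assume "(x, s - 1) \<in> ?C" "(x, s + 1) \<in> ?C"
        then show "(x, s) \<in> ?C"
          using rowC by fastforce
      next
        fix x s y r assume h: "(x, s) \<in> strip m {0..1}" "(y, s) \<in> ?C" "(x, r) \<in> ?C"
          "\<bar>x - y\<bar> = 1" "\<bar>s - r\<bar> = 1"
        then have y: "y = x + 1 \<or> y = x - 1" and sr: "s \<noteq> r"
          by auto
        show "(x, s) \<in> ?C"
        proof (cases "(x, s) \<in> A")
          case False
          then have "(y, s) \<in> A"
            using h y by auto
          moreover have "(x, r) \<in> A \<or> (y, r) \<in> A"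
            using h y by auto
          ultimately show ?thesis
            using row[of x r y s] row[of y s y r] h(4) sr by auto
        qed (use h in auto)
      qed auto
      then have "?C = strip m {0..1}"
        using sp A by (auto simp: spans_def)
      then have "(1, 0) \<in> ?C" "(1, 1) \<in> ?C"
        using m by (auto simp: strip_def)
      then show False
        using rowC[of 1 0 1] by simp
    qed
  qed
next
  assume h: "dense_cols m A \<and> (\<exists>i i'. seed 1 A i i')"
  then obtain i i' where s: "seed 1 A i i'" by blast
  have R: "(x, 0) \<in> strip m {0..1} \<and> (x, 1) \<in> strip m {0..1}" if "x = i \<or> x = i'" for x
    using that s A by (auto simp: seed_def strip_def)
  show "spans (strip m {0..1}) A"
    unfolding spans_def
  proof (intro conjI allI impI A)
    fix C assume C: "closed_in (strip m {0..1}) C" "A \<subseteq> C"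
    have "(i, 0) \<in> C" "(i, 1) \<in> C"
      using seed_fills[OF C s _ R] by auto
    moreover have "{0..1::int} = {0, 1}"
      by auto
    ultimately have "{i} \<times> {0..1} \<subseteq> C" by auto
    then show "C = strip m {0..1}"
      using full_column_spreads[OF C, of i] h R[of i] by (auto simp: strip_def)
  qed
qed

lemma min_spans_two_rows_bound:
  assumes m: "m \<ge> 1" and min: "min_spans (strip m {0..1}) A"
  shows "3 * int (card A) \<le> 2 * m + 4"
proof -
  have A: "A \<subseteq> strip m {0..1}"
    using min by (simp add: min_spans_def spans_def)
  have rows: "s = 0 \<or> s = 1" if "(x, s) \<in> A" for x s
    using that A by (auto simp: strip_def)
  obtain i i' where d: "dense_cols m A" and s: "seed 1 A i i'"
    using min spans_two_rows_iff[OF m A] by (auto simp: min_spans_def)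
  have red: "\<not> seed 1 B k k'" if "B \<subset> A" "dense_cols m B" for B k k'
    using that min spans_two_rows_iff[OF m, of B] A by (auto simp: min_spans_def)
  have double: "(j, 0) \<notin> A \<or> (j, 1) \<notin> A" if "j \<noteq> i \<or> i \<noteq> i'" for j
  proof (rule ccontr)
    assume c: "\<not> ?thesis"
    define w where "w = (j, if j = i' then 1 else 0 :: int)"
    have "dense_cols m (A - {w})"
      using dense_cols_remove_double[OF d, of w "(j, 1 - snd w)"] c by (auto simp: w_def)
    moreover have "A - {w} \<subset> A"
      using c by (auto simp: w_def)
    moreover have "seed 1 (A - {w}) i i'"
      using s that by (auto simp: seed_def w_def)
    ultimately show False
      using red by blast
  qed
  have window: "j \<in> {i, i'}" if "j \<in> occ A" "j - 1 \<in> occ A" "j + 1 \<in> occ A" for j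
  proof (rule ccontr)
    assume "j \<notin> {i, i'}"
    then have "seed 1 (del_col A j) i i'"
      using s by (auto simp: seed_def del_col_def)
    then show False
      using red[OF del_col_psubset dense_cols_del_col[OF d]] that by blast
  qed
  have "3 * int (card A) \<le> 2 * m + 2 + int 2"
  proof (cases "i = i'")
    case False
    have inj: "inj_on fst (A - {})"
    proof (rule inj_on_fstI)
      fix x s r assume "(x, s) \<in> A - {}" "(x, r) \<in> A - {}"
      then show "s = r"
        using rows[of x s] rows[of x r] double[of x] False by auto
    qed
    show ?thesis
      by (rule card_strip_bound[OF A _ inj, where X = "{i, i'}" and I = "{}"])
         (use m window False in auto)
  next
    case True
    have c: "(i, 0) \<in> A" "(i, 1) \<in> A"
      using s True by (auto simp: seed_def)
    have iso: "y \<notin> occ A" if "\<bar>i - y\<bar> = 1" for y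
    proof
      assume "y \<in> occ A"
      then obtain r where r: "(y, r) \<in> A" "r = 0 \<or> r = 1"
        using rows by (auto simp: occ_iff)
      have "dense_cols m (A - {(i, r)})"
        using dense_cols_remove_double[OF d, of "(i, r)" "(i, 1 - r)"] c r by auto
      moreover have "seed 1 (A - {(i, r)}) y i \<or> seed 1 (A - {(i, r)}) i y"
        using r c that by (auto simp: seed_def)
      moreover have "A - {(i, r)} \<subset> A"
        using c r by auto
      ultimately show False
        using red by blast
    qed
    have iso': "i \<in> occ A" "i - 1 \<notin> occ A" "i + 1 \<notin> occ A"
      using iso[of "i - 1"] iso[of "i + 1"] c by (auto simp: occ_iff)
    have inj: "inj_on fst (A - {(i, 0)})"
    proof (rule inj_on_fstI)
      fix x s r assume "(x, s) \<in> A - {(i, 0)}" "(x, r) \<in> A - {(i, 0)}"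
      then show "s = r"
        using rows[of x s] rows[of x r] double[of x] by auto
    qed
    show ?thesis
      by (rule card_strip_bound[OF A _ inj, where X = "{}" and I = "{i}"])
         (use m window True iso' in auto)
  qed
  then show ?thesis
    by simp
qed

subsection \<open>Three rows\<close>

text \<open>The rows are numbered \<open>-1, 0, 1\<close>, and \<open>\<sigma>\<close> is the sign of an outer row. If \<open>A\<close> is dense, the
  rows \<open>0\<close> and \<open>\<sigma>\<close> of a block become fully infected without the help of row \<open>-\<sigma>\<close>.\<close>

definition block :: "int \<Rightarrow> (int \<times> int) set \<Rightarrow> int \<Rightarrow> int \<Rightarrow> int \<Rightarrow> int \<Rightarrow> bool" where
  "block \<sigma> A p q i i' \<longleftrightarrow> seed \<sigma> A i i' \<and> i \<in> {p..q} \<and> i' \<in> {p..q} \<and> p \<in> occ A \<and> q \<in> occ A \<and>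
     (\<forall>x\<in>{p..q}. (x, -\<sigma>) \<notin> A)"

definition blocked :: "int \<Rightarrow> (int \<times> int) set \<Rightarrow> int set" where
  "blocked \<sigma> A = {x. \<exists>p q i i'. x \<in> {p..q} \<and> block \<sigma> A p q i i'}"

lemma blockedI: "block \<sigma> A p q i i' \<Longrightarrow> x \<in> {p..q} \<Longrightarrow> x \<in> blocked \<sigma> A"
  by (auto simp: blocked_def)

lemma blocked_no_opposite: "x \<in> blocked \<sigma> A \<Longrightarrow> (x, -\<sigma>) \<notin> A"
  by (auto simp: blocked_def block_def)

lemma blocked_extend:
  assumes z: "z \<in> blocked \<sigma> A" and w: "w \<in> occ A"
    and free: "\<And>y. y \<in> {min z w..max z w} \<Longrightarrow> (y, -\<sigma>) \<notin> A" and x: "x \<in> {min z w..max z w}"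
  shows "x \<in> blocked \<sigma> A"
proof -
  obtain p q i i' where z: "z \<in> {p..q}" and b: "block \<sigma> A p q i i'"
    using z by (auto simp: blocked_def)
  have f: "(y, -\<sigma>) \<notin> A" if "y \<in> {min p w..max q w}" for y
  proof (cases "y \<in> {p..q}")
    case True
    then show ?thesis using b by (auto simp: block_def)
  next
    case False
    then have "y \<in> {min z w..max z w}"
      using that z by (auto simp: min_def max_def split: if_splits)
    then show ?thesis by (rule free)
  qed
  have "min p w \<in> occ A" "max q w \<in> occ A"
    using b w by (auto simp: block_def min_def max_def)
  then have "block \<sigma> A (min p w) (max q w) i i'"
    using b f by (auto simp: block_def)
  then show ?thesis
    by (rule blockedI) (use x z in \<open>auto simp: min_def max_def split: if_splits\<close>)
qed

lemma block_mono:
  assumes "block \<sigma> A p q i i'" and "B \<subseteq> A" and "(i, \<sigma>) \<in> B" "(i', 0) \<in> B"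
    and "p \<in> occ B" "q \<in> occ B"
  shows "block \<sigma> B p q i i'"
  using assms by (auto simp: block_def seed_def)

lemma blocked_del_col:
  assumes b: "block \<sigma> A p q i i'" and j: "j \<noteq> i" "j \<noteq> i'" "j - 1 \<in> occ A" "j + 1 \<in> occ A"
    and x: "x \<in> {p..q}" "x \<noteq> j"
  shows "x \<in> blocked \<sigma> (del_col A j)"
proof -
  define p' where "p' = (if j = p then p + 1 else p)"
  define q' where "q' = (if j = q then q - 1 else q)"
  have "block \<sigma> (del_col A j) p' q' i i'"
    unfolding block_def seed_def
  proof (intro conjI ballI)
    show "p' \<in> occ (del_col A j)" "q' \<in> occ (del_col A j)"
      using b j by (auto simp: block_def occ_del_col p'_def q'_def)
    show "i \<in> {p'..q'}" "i' \<in> {p'..q'}"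
      using b j by (auto simp: block_def p'_def q'_def)
  qed (use b j in \<open>auto simp: block_def seed_def del_col_def p'_def q'_def split: if_splits\<close>)
  then show ?thesis
    by (rule blockedI) (use x in \<open>auto simp: p'_def q'_def\<close>)
qed

text \<open>The four ways in which \<open>A\<close> can fill a whole column: two cells in the outer rows of a column;
  the same after one of them arises between two cells of \<open>A\<close>; a block next to a cell in the
  opposite outer row; two opposite blocks at distance at most two.\<close>

definition filling :: "(int \<times> int) set \<Rightarrow> bool" where
  "filling A \<longleftrightarrow> (\<exists>\<sigma>\<in>{-1, 1}. \<exists>x.
     (x, \<sigma>) \<in> A \<and> (x, -\<sigma>) \<in> A \<or>
     (x - 1, \<sigma>) \<in> A \<and> (x + 1, \<sigma>) \<in> A \<and> (x, -\<sigma>) \<in> A \<or>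
     x \<in> blocked \<sigma> A \<and> (\<exists>y. \<bar>x - y\<bar> = 1 \<and> (y, -\<sigma>) \<in> A) \<or>
     x \<in> blocked \<sigma> A \<and> (\<exists>y. \<bar>x - y\<bar> \<le> 2 \<and> y \<in> blocked (-\<sigma>) A))"

lemma fillingI:
  assumes "\<sigma> = -1 \<or> \<sigma> = 1"
  shows "(x, \<sigma>) \<in> A \<Longrightarrow> (x, -\<sigma>) \<in> A \<Longrightarrow> filling A"
    and "(x - 1, \<sigma>) \<in> A \<Longrightarrow> (x + 1, \<sigma>) \<in> A \<Longrightarrow> (x, -\<sigma>) \<in> A \<Longrightarrow> filling A"
    and "x \<in> blocked \<sigma> A \<Longrightarrow> \<bar>x - y\<bar> = 1 \<Longrightarrow> (y, -\<sigma>) \<in> A \<Longrightarrow> filling A"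
    and "x \<in> blocked \<sigma> A \<Longrightarrow> \<bar>x - y\<bar> \<le> 2 \<Longrightarrow> y \<in> blocked (-\<sigma>) A \<Longrightarrow> filling A"
  by (unfold filling_def, insert assms; blast)+

lemma fillingE:
  assumes "filling A"
  obtains (outer) \<sigma> x where "\<sigma> = -1 \<or> \<sigma> = 1" "(x, \<sigma>) \<in> A" "(x, -\<sigma>) \<in> A"
  | (gap) \<sigma> x where "\<sigma> = -1 \<or> \<sigma> = 1" "(x - 1, \<sigma>) \<in> A" "(x + 1, \<sigma>) \<in> A" "(x, -\<sigma>) \<in> A"
  | (cell) \<sigma> x y where "\<sigma> = -1 \<or> \<sigma> = 1" "x \<in> blocked \<sigma> A" "\<bar>x - y\<bar> = 1" "(y, -\<sigma>) \<in> A"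
  | (opposite) \<sigma> x y where "\<sigma> = -1 \<or> \<sigma> = 1" "x \<in> blocked \<sigma> A" "\<bar>x - y\<bar> \<le> 2" "y \<in> blocked (-\<sigma>) A"
proof -
  obtain \<sigma> x where \<sigma>: "\<sigma> = -1 \<or> \<sigma> = 1" and
    "(x, \<sigma>) \<in> A \<and> (x, -\<sigma>) \<in> A \<or>
     (x - 1, \<sigma>) \<in> A \<and> (x + 1, \<sigma>) \<in> A \<and> (x, -\<sigma>) \<in> A \<or>
     x \<in> blocked \<sigma> A \<and> (\<exists>y. \<bar>x - y\<bar> = 1 \<and> (y, -\<sigma>) \<in> A) \<or>
     x \<in> blocked \<sigma> A \<and> (\<exists>y. \<bar>x - y\<bar> \<le> 2 \<and> y \<in> blocked (-\<sigma>) A)"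
    using assms unfolding filling_def by blast
  from this(2) show thesis
    using outer[OF \<sigma>] gap[OF \<sigma>] cell[OF \<sigma>] opposite[OF \<sigma>] by blast
qed

lemma between_adjacent:
  fixes a b z :: int
  assumes "\<bar>a - b\<bar> = 1" "z \<in> {min a b..max a b}"
  shows "z = a \<or> z = b"
proof -
  have "b = a + 1 \<or> a = b + 1"
    using assms(1) by linarith
  then show ?thesis
    using assms(2) by (elim disjE) auto
qed

lemma between_common_neighbour:
  fixes a b x z :: int
  assumes "\<bar>a - x\<bar> = 1" "\<bar>b - x\<bar> = 1" "a \<noteq> b"
  shows "x \<in> {min a b..max a b}" "z \<in> {min a b..max a b} \<Longrightarrow> z = a \<or> z = x \<or> z = b"
proof -
  have "a = x - 1 \<and> b = x + 1 \<or> a = x + 1 \<and> b = x - 1"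
    using assms by linarith
  then show "x \<in> {min a b..max a b}" "z \<in> {min a b..max a b} \<Longrightarrow> z = a \<or> z = x \<or> z = b"
    by (elim disjE; simp; linarith)+
qed

lemma spans_filling:
  assumes sp: "spans (strip m {-1..1}) A" and m: "m \<ge> 1"
  shows "filling A"
proof (rule ccontr)
  assume nf: "\<not> filling A"
  have sub: "A \<subseteq> strip m {-1..1}"
    using sp by (simp add: spans_def)
  have n1: "\<not> ((x, \<sigma>) \<in> A \<and> (x, -\<sigma>) \<in> A)" if "\<sigma> = -1 \<or> \<sigma> = 1" for x \<sigma>
    using nf that unfolding filling_def by blast
  have n2: "\<not> ((x - 1, \<sigma>) \<in> A \<and> (x + 1, \<sigma>) \<in> A \<and> (x, -\<sigma>) \<in> A)" if "\<sigma> = -1 \<or> \<sigma> = 1" for x \<sigma>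
    using nf that unfolding filling_def by blast
  have n3: "(y, -\<sigma>) \<notin> A" if "\<sigma> = -1 \<or> \<sigma> = 1" "x \<in> blocked \<sigma> A" "\<bar>x - y\<bar> = 1" for x y \<sigma>
    using nf that unfolding filling_def by blast
  have n4: "\<bar>x - y\<bar> > 2" if "\<sigma> = -1 \<or> \<sigma> = 1" "x \<in> blocked \<sigma> A" "y \<in> blocked (-\<sigma>) A" for x y \<sigma>
    using nf that unfolding filling_def by (meson insertCI linorder_not_less)
  have c1: "x \<in> blocked \<sigma> A" if "\<sigma> = -1 \<or> \<sigma> = 1" "(x, \<sigma>) \<in> A" "(x, 0) \<in> A" for x \<sigma>
  proof -
    have "block \<sigma> A x x x x"
      using that n1[of \<sigma> x] by (auto simp: block_def seed_def occ_iff)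
    then show ?thesis
      by (rule blockedI) simp
  qed
  have c2: "x \<in> blocked \<sigma> A \<and> y \<in> blocked \<sigma> A"
    if \<sigma>: "\<sigma> = -1 \<or> \<sigma> = 1" and h: "(x, \<sigma>) \<in> A" "(y, 0) \<in> A" "\<bar>x - y\<bar> = 1" for x y \<sigma>
  proof -
    have "(y, -\<sigma>) \<notin> A"
    proof
      assume "(y, -\<sigma>) \<in> A"
      then have "y \<in> blocked (-\<sigma>) A"
        using c1[of "-\<sigma>" y] h \<sigma> by auto
      then show False
        using n3[of "-\<sigma>" y x] \<sigma> h abs_minus_commute[of x y] by auto
    qed
    then have free: "(z, -\<sigma>) \<notin> A" if "z = x \<or> z = y" for z
      using that h n1[OF \<sigma>, of x] by auto
    have "min x y \<in> occ A" "max x y \<in> occ A"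
      using h by (auto simp: occ_iff min_def max_def)
    moreover have "(z, -\<sigma>) \<notin> A" if "z \<in> {min x y..max x y}" for z
    proof (rule free)
      show "z = x \<or> z = y"
        using between_adjacent[OF h(3) that] .
    qed
    ultimately have "block \<sigma> A (min x y) (max x y) x y"
      using h unfolding block_def seed_def by auto
    then show ?thesis
      using blockedI[of \<sigma> A "min x y" "max x y" x y] by auto
  qed
  have e1: "x \<in> blocked \<sigma> A" if "\<sigma> = -1 \<or> \<sigma> = 1" "z \<in> blocked \<sigma> A" "\<bar>z - x\<bar> = 1" "x \<in> occ A" for x z \<sigma>
  proof (rule blocked_extend[OF that(2,4)])
    fix y assume "y \<in> {min z x..max z x}"
    then have "y = z \<or> y = x"
      using between_adjacent[OF that(3)] by blast
    then show "(y, -\<sigma>) \<notin> A"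
      using blocked_no_opposite[OF that(2)] n3[OF that(1-3)] by auto
  qed auto
  have e2: "x \<in> blocked \<sigma> A" if "\<sigma> = -1 \<or> \<sigma> = 1" "z \<in> blocked \<sigma> A" "\<bar>z - x\<bar> = 1" "\<bar>w - x\<bar> = 1" "z \<noteq> w"
    "w \<in> occ A" "(w, -\<sigma>) \<notin> A" for x z w \<sigma>
  proof (rule blocked_extend[OF that(2,6)])
    fix y assume "y \<in> {min z w..max z w}"
    then have "y = z \<or> y = x \<or> y = w"
      using between_common_neighbour(2)[OF that(3-5)] by blast
    then show "(y, -\<sigma>) \<notin> A"
      using blocked_no_opposite[OF that(2)] n3[OF that(1-3)] that(7) by auto
  next
    show "x \<in> {min z w..max z w}"
      using between_common_neighbour(1)[OF that(3-5)] .
  qed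
  have e3: "x \<in> blocked \<sigma> A" if "\<sigma> = -1 \<or> \<sigma> = 1" "z \<in> blocked \<sigma> A" "\<bar>z - x\<bar> = 1" "\<bar>w - x\<bar> = 1" "z \<noteq> w"
    "(w, s) \<in> A" "s = 0 \<or> s = \<sigma>" for x z w s \<sigma>
  proof (rule e2[OF that(1-5)])
    show "w \<in> occ A" using that by (auto simp: occ_iff)
    show "(w, -\<sigma>) \<notin> A"
    proof
      assume a: "(w, -\<sigma>) \<in> A"
      then have "s = 0"
        using n1[OF that(1), of w] that(6,7) by auto
      then have "w \<in> blocked (-\<sigma>) A"
        using c1[of "-\<sigma>" w] a that by auto
      then show False
        using n4[OF that(1,2)] that(3,4) by fastforce
    qed
  qed
  let ?F = "\<lambda>x s. (x - 1, s) \<in> A \<and> (x + 1, s) \<in> A"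
  let ?Z = "\<lambda>x s. \<exists>\<sigma>. (\<sigma> = -1 \<or> \<sigma> = 1) \<and> x \<in> blocked \<sigma> A \<and> (s = 0 \<or> s = \<sigma>)"
  define K where "K x s \<longleftrightarrow> (x, s) \<in> A \<or> ?F x s \<or> ?Z x s" for x s
  have KE: thesis if "K x s" "(x, s) \<in> A \<Longrightarrow> thesis" "?F x s \<Longrightarrow> thesis"
      "\<And>\<sigma>. \<sigma> = -1 \<or> \<sigma> = 1 \<Longrightarrow> x \<in> blocked \<sigma> A \<Longrightarrow> s = 0 \<or> s = \<sigma> \<Longrightarrow> thesis" for x s thesis
    using that unfolding K_def by blast
  have KZ: "K x s" if "\<sigma> = -1 \<or> \<sigma> = 1" "x \<in> blocked \<sigma> A" "s = 0 \<or> s = \<sigma>" for x s \<sigma>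
    using that unfolding K_def by blast
  let ?C = "{(x, s). K x s} \<inter> strip m {-1..1}"
  have outer: "\<not> (K x \<sigma> \<and> K x (-\<sigma>))" if \<sigma>: "\<sigma> = 1" for x \<sigma>
  proof
    have noAK: False if "(x, \<tau>) \<in> A" "K x (-\<tau>)" "\<tau> = -1 \<or> \<tau> = 1" for \<tau>
      using that(2)
    proof (rule KE)
      fix \<rho> assume "\<rho> = -1 \<or> \<rho> = 1" "x \<in> blocked \<rho> A" "-\<tau> = 0 \<or> -\<tau> = \<rho>"
      then show False
        using blocked_no_opposite[of x \<rho> A] that by auto
    qed (use n1[OF that(3), of x] n2[of "-\<tau>" x] that in auto)
    have noFZ: False if "?F x \<tau>" "K x (-\<tau>)" "\<tau> = -1 \<or> \<tau> = 1" for \<tau>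
      using that(2)
    proof (rule KE)
      fix \<rho> assume "\<rho> = -1 \<or> \<rho> = 1" "x \<in> blocked \<rho> A" "-\<tau> = 0 \<or> -\<tau> = \<rho>"
      then show False
        using n3[of \<rho> x "x - 1"] that by auto
    next
      assume "(x, - \<tau>) \<in> A"
      then show False using n2[OF that(3), of x] that by auto
    next
      assume "?F x (-\<tau>)"
      then show False using n1[OF that(3), of "x - 1"] that by auto
    qed
    assume "K x \<sigma> \<and> K x (-\<sigma>)"
    then have k: "K x \<sigma>" "K x (-\<sigma>)" by auto
    from k(1) show False
    proof (rule KE)
      fix \<rho> assume r: "\<rho> = -1 \<or> \<rho> = 1" "x \<in> blocked \<rho> A" "\<sigma> = 0 \<or> \<sigma> = \<rho>"
      from k(2) show False
      proof (rule KE)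
        fix \<rho>' assume "\<rho>' = -1 \<or> \<rho>' = 1" "x \<in> blocked \<rho>' A" "-\<sigma> = 0 \<or> -\<sigma> = \<rho>'"
        then show False using n4[of \<rho> x x] r \<sigma> by auto
      qed (use noAK[of "-\<sigma>"] noFZ[of "-\<sigma>"] k \<sigma> in auto)
    qed (use noAK[of \<sigma>] noFZ[of \<sigma>] k \<sigma> in auto)
  qed
  have "closed_in (strip m {-1..1}) ?C"
  proof (rule closed_inI)
    fix x s assume h: "(x, s) \<in> strip m {-1..1}" "(x, s - 1) \<in> ?C" "(x, s + 1) \<in> ?C"
    then have "s = 0"
      by (auto simp: strip_def)
    then show "(x, s) \<in> ?C"
      using outer[of 1 x] h by auto
  next
    fix x s assume h: "(x, s) \<in> strip m {-1..1}" "(x - 1, s) \<in> ?C" "(x + 1, s) \<in> ?C"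
    then have k: "K (x - 1) s" "K (x + 1) s"
      by auto
    have "K x s"
      using k(1)
    proof (rule KE)
      assume 1: "(x - 1, s) \<in> A"
      from k(2) show "K x s"
      proof (rule KE)
        fix \<sigma> assume "\<sigma> = -1 \<or> \<sigma> = 1" "x + 1 \<in> blocked \<sigma> A" "s = 0 \<or> s = \<sigma>"
        then show ?thesis
          using e3[of \<sigma> "x + 1" x "x - 1" s] 1 KZ by auto
      qed (use 1 in \<open>auto simp: K_def\<close>)
    next
      fix \<sigma> assume 1: "\<sigma> = -1 \<or> \<sigma> = 1" "x - 1 \<in> blocked \<sigma> A" "s = 0 \<or> s = \<sigma>"
      from k(2) show "K x s"
      proof (rule KE)
        assume "(x + 1, s) \<in> A"
        then show ?thesis
          using e3[of \<sigma> "x - 1" x "x + 1" s] 1 KZ by auto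
      next
        fix \<tau> assume 2: "\<tau> = -1 \<or> \<tau> = 1" "x + 1 \<in> blocked \<tau> A" "s = 0 \<or> s = \<tau>"
        show ?thesis
        proof (cases "\<sigma> = \<tau>")
          case False
          then have "\<tau> = -\<sigma>" using 1 2 by auto
          then show ?thesis using n4[of \<sigma> "x - 1" "x + 1"] 1 2 by auto
        next
          case True
          obtain p q i i' where pq: "x + 1 \<in> {p..q}" "block \<tau> A p q i i'"
            using 2 by (auto simp: blocked_def)
          have nx: "(x, -\<sigma>) \<notin> A"
            using n3[OF 1(1,2), of x] by auto
          have "x \<in> blocked \<sigma> A"
          proof (rule blocked_extend[OF 1(2), of q])
            show "q \<in> occ A" using pq by (auto simp: block_def)
            show "x \<in> {min (x - 1) q..max (x - 1) q}" using pq by auto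
            fix y assume y: "y \<in> {min (x - 1) q..max (x - 1) q}"
            consider "y = x - 1" | "y = x" | "y \<ge> x + 1" "y \<le> q"
              using y pq by fastforce
            then show "(y, -\<sigma>) \<notin> A"
              by cases (use nx blocked_no_opposite[OF 1(2)] pq True in \<open>auto simp: block_def\<close>)
          qed
          then show ?thesis
            using KZ 1 by blast
        qed
      qed (auto simp: K_def)
    qed (auto simp: K_def)
    then show "(x, s) \<in> ?C"
      using h by auto
  next
    fix x s y r assume h: "(x, s) \<in> strip m {-1..1}" "(y, s) \<in> ?C" "(x, r) \<in> ?C"
      "\<bar>x - y\<bar> = 1" "\<bar>s - r\<bar> = 1"
    then have k: "K y s" "K x r"
      by auto
    have rng: "s = -1 \<or> s = 0 \<or> s = 1" "r = -1 \<or> r = 0 \<or> r = 1"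
      using h by (auto simp: strip_def)
    define \<sigma> where "\<sigma> = s + r"
    have \<sigma>: "\<sigma> = -1 \<or> \<sigma> = 1" "s = 0 \<and> r = \<sigma> \<or> s = \<sigma> \<and> r = 0"
      using rng h(5) unfolding \<sigma>_def by (elim disjE; simp)+
    have yx: "y = x + 1 \<or> y = x - 1"
      using h(4) by linarith
    have Fr: "(y, r) \<in> A \<and> (2 * x - y, r) \<in> A" if "?F x r"
      using that yx by (auto simp: algebra_simps)
    have Fs: "(x, s) \<in> A" if "?F y s"
      using that yx by auto
    have dist: "\<bar>y - x\<bar> = 1" "\<bar>2 * x - y - x\<bar> = 1" "y \<noteq> 2 * x - y"
      using h(4) by auto
    have "K x s"
      using k(1)
    proof (rule KE)
      assume 1: "(y, s) \<in> A"
      from k(2) show "K x s"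
      proof (rule KE)
        assume "(x, r) \<in> A"
        then have "x \<in> blocked \<sigma> A"
          using c2[OF \<sigma>(1), of x y] c2[OF \<sigma>(1), of y x] 1 \<sigma>(2) h(4) dist by auto
        then show ?thesis
          using KZ[OF \<sigma>(1)] \<sigma>(2) by blast
      next
        assume "?F x r"
        then have f: "(y, r) \<in> A" "(2 * x - y, r) \<in> A"
          using Fr by auto
        then have "y \<in> blocked \<sigma> A"
          using c1[OF \<sigma>(1), of y] 1 \<sigma>(2) by auto
        then have "x \<in> blocked \<sigma> A"
          using e3[OF \<sigma>(1) _ dist f(2)] \<sigma>(2) by blast
        then show ?thesis
          using KZ[OF \<sigma>(1)] \<sigma>(2) by blast
      next
        fix \<tau> assume 2: "\<tau> = -1 \<or> \<tau> = 1" "x \<in> blocked \<tau> A" "r = 0 \<or> r = \<tau>"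
        have "s \<noteq> -\<tau>"
          using n3[OF 2(1,2) h(4)] 1 by auto
        then show ?thesis
          using KZ[OF 2(1,2)] 2 rng by auto
      qed
    next
      assume "?F y s"
      then show ?thesis using Fs by (simp add: K_def)
    next
      fix \<tau> assume 1: "\<tau> = -1 \<or> \<tau> = 1" "y \<in> blocked \<tau> A" "s = 0 \<or> s = \<tau>"
      have "x \<in> blocked \<tau> A"
        using k(2)
      proof (rule KE)
        assume "(x, r) \<in> A"
        then show ?thesis using e1[OF 1(1,2) dist(1)] by (auto simp: occ_iff)
      next
        assume "?F x r"
        then have f: "(y, r) \<in> A" "(2 * x - y, r) \<in> A"
          using Fr by auto
        then have "r \<noteq> -\<tau>"
          using blocked_no_opposite[OF 1(2)] by auto
        then show ?thesis
          using e3[OF 1(1,2) dist f(2)] rng 1(1) by auto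
      next
        fix \<rho> assume 2: "\<rho> = -1 \<or> \<rho> = 1" "x \<in> blocked \<rho> A"
        show ?thesis
        proof (cases "\<rho> = \<tau>")
          case False
          then have "\<rho> = -\<tau>" using 1 2 by auto
          then show ?thesis using n4[OF 1(1,2), of x] 2 dist by auto
        qed (use 2 in simp)
      qed
      then show ?thesis
        using KZ 1 by blast
    qed
    then show "(x, s) \<in> ?C"
      using h by auto
  qed auto
  moreover have "A \<subseteq> ?C"
    using sub by (auto simp: K_def)
  ultimately have "?C = strip m {-1..1}"
    using sp by (simp add: spans_def)
  moreover have "(1, 1) \<in> strip m {-1..1}" "(1, -1) \<in> strip m {-1..1}"
    using m by (auto simp: strip_def)
  ultimately have "(1, 1) \<in> ?C" "(1, -1) \<in> ?C"
    by simp_all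
  then show False
    using outer[of 1 1] by simp
qed

lemma blocked_fills:
  assumes C: "closed_in (strip m {-1..1}) C" and AC: "A \<subseteq> C" and d: "dense_cols m A"
    and \<sigma>: "\<sigma> = -1 \<or> \<sigma> = 1" and x: "x \<in> blocked \<sigma> A"
  shows "x \<in> {1..m} \<and> (x, 0) \<in> C \<and> (x, \<sigma>) \<in> C"
proof -
  obtain p q i i' where pq: "x \<in> {p..q}" and b: "block \<sigma> A p q i i'"
    using x by (auto simp: blocked_def)
  have CR: "C \<subseteq> strip m {-1..1}"
    using C by (simp add: closed_in_def)
  have cells: "1 \<le> y \<and> y \<le> m \<and> -1 \<le> s \<and> s \<le> 1" if "(y, s) \<in> A" for y s
    using that AC CR by (auto simp: strip_def)
  have bounds: "1 \<le> p" "q \<le> m"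
    using b cells by (auto simp: block_def occ_iff)
  have R: "(y, 0) \<in> strip m {-1..1} \<and> (y, \<sigma>) \<in> strip m {-1..1}" if "y \<in> {p..q}" for y
    using that bounds \<sigma> by (auto simp: strip_def)
  have rows: "s = 0 \<or> s = \<sigma>" if "(y, s) \<in> A" "y \<in> {p..q}" for y s
  proof -
    have "s \<noteq> -\<sigma>" using that b by (auto simp: block_def)
    then show ?thesis using cells[OF that(1)] \<sigma> by auto
  qed
  define G where "G y \<longleftrightarrow> (y, 0) \<in> C \<and> (y, \<sigma>) \<in> C" for y
  have i: "i \<in> {p..q}" "i' \<in> {p..q}" "seed \<sigma> A i i'"
    using b by (auto simp: block_def)
  then have "G i"
    using seed_fills[OF C AC i(3)] R \<sigma> unfolding G_def by (metis abs_1 abs_minus_cancel)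
  have st: "G z" if "G y" "\<bar>z - y\<bar> = 1" "y \<in> {p..q}" "z \<in> {p..q}" for y z
  proof -
    have "\<exists>s. (z, s) \<in> C \<and> (s = 0 \<or> s = \<sigma>)"
    proof (cases "z \<in> occ A")
      case True
      then show ?thesis using rows that(4) AC by (auto simp: occ_iff)
    next
      case False
      have ends: "p \<in> occ A" "q \<in> occ A"
        using b by (auto simp: block_def)
      have w: "2 * z - y \<in> occ A" "2 * z - y \<in> {p..q}"
      proof -
        have "z = y + 1 \<or> z = y - 1" using that(2) by linarith
        moreover have "z \<noteq> p" "z \<noteq> q" using ends False by auto
        ultimately show "2 * z - y \<in> {p..q}" using that(3,4) by auto
        from \<open>z = y + 1 \<or> z = y - 1\<close> show "2 * z - y \<in> occ A"
        proof
          assume "z = y + 1"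
          then show ?thesis
            using d[unfolded dense_cols_def, rule_format, of z] False that(4) bounds
            by (simp add: add.commute)
        next
          assume "z = y - 1"
          then show ?thesis
            using d[unfolded dense_cols_def, rule_format, of "z - 1"] False that(4) bounds by simp
        qed
      qed
      then obtain s where s: "(2 * z - y, s) \<in> A"
        by (auto simp: occ_iff)
      then have s': "s = 0 \<or> s = \<sigma>"
        using rows w by blast
      have "(z, s) \<in> C"
        using that s s' AC R[OF that(4)]
        by (intro closed_in_hor[OF C, of z s y "2 * z - y"]) (auto simp: G_def)
      then show ?thesis using s' by blast
    qed
    then obtain s where s: "(z, s) \<in> C" "s = 0 \<or> s = \<sigma>" by blast
    have "(z, \<sigma> - s) \<in> C"
      using that s R[OF that(4)] \<sigma>
      by (intro closed_in_corner[OF C, of z "\<sigma> - s" y s]) (auto simp: G_def)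
    then show ?thesis using s by (auto simp: G_def)
  qed
  have right: "y \<le> q \<longrightarrow> G y" if "i \<le> y" for y
    using that
  proof (induction y rule: int_ge_induct)
    case (step j)
    then show ?case using st[of j "j + 1"] i by auto
  qed (use \<open>G i\<close> in auto)
  have left: "p \<le> y \<longrightarrow> G y" if "y \<le> i" for y
    using that
  proof (induction y rule: int_le_induct)
    case (step j)
    then show ?case using st[of j "j - 1"] i by auto
  qed (use \<open>G i\<close> in auto)
  show ?thesis
    using right[of x] left[of x] pq bounds by (cases "i \<le> x") (auto simp: G_def)
qed

lemma filling_spans:
  assumes A: "A \<subseteq> strip m {-1..1}" and d: "dense_cols m A" and f: "filling A"
  shows "spans (strip m {-1..1}) A"
  unfolding spans_def
proof (intro conjI allI impI A)
  fix C assume C: "closed_in (strip m {-1..1}) C" and AC: "A \<subseteq> C"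
  have CR: "C \<subseteq> strip m {-1..1}"
    using C by (simp add: closed_in_def)
  have cells: "1 \<le> y \<and> y \<le> m" if "(y, s) \<in> C" for y s
    using that CR by (auto simp: strip_def)
  have R: "(y, s) \<in> strip m {-1..1}" if "1 \<le> y" "y \<le> m" "s = -1 \<or> s = 0 \<or> s = 1" for y s
    using that by (auto simp: strip_def)
  have column: "C = strip m {-1..1}" if \<sigma>: "\<sigma> = -1 \<or> \<sigma> = 1" and o: "(x, \<sigma>) \<in> C" "(x, -\<sigma>) \<in> C" for x \<sigma>
  proof -
    have x: "1 \<le> x" "x \<le> m" using cells o by auto
    have "(x, -1) \<in> C" "(x, 1) \<in> C" using \<sigma> o by auto
    moreover from this have "(x, 0) \<in> C"
      using R[OF x, of 0] closed_in_ver[OF C, of x 0] by simp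
    moreover have "{-1..1::int} = {-1, 0, 1}" by auto
    ultimately have "{x} \<times> {-1..1} \<subseteq> C" by auto
    then show ?thesis
      using full_column_spreads[OF C AC d, of x] x by simp
  qed
  note fills = blocked_fills[OF C AC d]
  have near: "C = strip m {-1..1}" if \<sigma>: "\<sigma> = -1 \<or> \<sigma> = 1"
    and "(x, 0) \<in> C" "(x, \<sigma>) \<in> C" "(y, -\<sigma>) \<in> C" "\<bar>x - y\<bar> = 1" for \<sigma> x y
  proof (rule column[OF \<sigma> that(3)])
    show "(x, -\<sigma>) \<in> C"
      using that cells[OF that(2)] R by (intro closed_in_corner[OF C, of x "-\<sigma>" y 0]) auto
  qed
  show "C = strip m {-1..1}"
    using f
  proof (cases rule: fillingE)
    case (outer \<sigma> x)
    then show ?thesis using column AC by blast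
  next
    case (gap \<sigma> x)
    then have "(x, \<sigma>) \<in> C"
      using AC cells[of x "-\<sigma>"] R by (intro closed_in_hor[OF C, of x \<sigma> "x - 1" "x + 1"]) auto
    then show ?thesis using column[OF gap(1)] AC gap by blast
  next
    case (cell \<sigma> x y)
    then show ?thesis using near[OF cell(1)] fills[OF cell(1)] AC by blast
  next
    case h: (opposite \<sigma> x y)
    note \<sigma> = h(1)
    have X: "(x, 0) \<in> C" "(x, \<sigma>) \<in> C" "1 \<le> x" "x \<le> m" using fills[OF \<sigma> h(2)] by auto
    have Y: "(y, 0) \<in> C" "(y, -\<sigma>) \<in> C" "1 \<le> y" "y \<le> m" using fills[OF _ h(4)] \<sigma> by auto
    consider "x = y" | "\<bar>x - y\<bar> = 1" | "\<bar>x - y\<bar> = 2"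
      using h(3) by linarith
    then show ?thesis
    proof cases
      case 1
      then show ?thesis using column[OF \<sigma>] X Y by blast
    next
      case 2
      then show ?thesis using near[OF \<sigma>] X Y by blast
    next
      case 3
      define z where "z = (if x < y then x + 1 else y + 1)"
      have z: "\<bar>z - x\<bar> = 1" "\<bar>z - y\<bar> = 1" "x \<noteq> y"
        using 3 by (auto simp: z_def)
      have zb: "1 \<le> z" "z \<le> m" using z X Y by auto
      have z0: "(z, 0) \<in> C"
        using z X Y R zb by (intro closed_in_hor[OF C, of z 0 x y]) auto
      have "(z, \<sigma>) \<in> C"
        using z X z0 R zb \<sigma> by (intro closed_in_corner[OF C, of z \<sigma> x 0]) auto
      moreover have "(z, -\<sigma>) \<in> C"
        using z Y z0 R zb \<sigma> by (intro closed_in_corner[OF C, of z "-\<sigma>" y 0]) auto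
      ultimately show ?thesis using column[OF \<sigma>] by blast
    qed
  qed
qed

lemma block_remove:
  assumes b: "block \<sigma> A p q i i'" and w: "w \<in> A" "v \<in> A" "fst w = fst v" "w \<noteq> v"
    and n: "w \<noteq> (i, \<sigma>)" "w \<noteq> (i', 0)"
  shows "block \<sigma> (A - {w}) p q i i'"
proof (rule block_mono[OF b])
  have "occ (A - {w}) = occ A"
    by (rule occ_remove_double[OF w])
  then show "p \<in> occ (A - {w})" "q \<in> occ (A - {w})"
    using b by (auto simp: block_def)
qed (use b n in \<open>auto simp: block_def seed_def\<close>)

text \<open>A seed occupying a single column can be traded for a diagonal one as soon as a neighbouring
  column is occupied, which makes one of its two cells superfluous.\<close>

lemma block_swap:
  assumes b: "block \<sigma> A p q i i" and y: "y \<in> occ A" "\<bar>i - y\<bar> = 1" "(y, -\<sigma>) \<notin> A"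
    and rows: "\<And>x s. (x, s) \<in> A \<Longrightarrow> s = 0 \<or> s = \<sigma> \<or> s = -\<sigma>" and \<sigma>: "\<sigma> \<noteq> 0"
  shows "\<exists>r. (r = 0 \<or> r = \<sigma>) \<and> {p..q} \<subseteq> blocked \<sigma> (A - {(i, r)})"
proof -
  obtain r where r: "(y, r) \<in> A" "r = 0 \<or> r = \<sigma>"
    using y rows by (auto simp: occ_iff)
  have c: "(i, 0) \<in> A" "(i, \<sigma>) \<in> A" "p \<le> i" "i \<le> q"
    using b by (auto simp: block_def seed_def)
  let ?B = "A - {(i, r)}"
  define j where "j = (if r = \<sigma> then y else i)"
  define j' where "j' = (if r = \<sigma> then i else y)"
  have yi: "y = i + 1 \<or> y = i - 1"
    using y(2) by linarith
  have free: "(z, -\<sigma>) \<notin> ?B" if "z \<in> {min p y..max q y}" for z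
  proof -
    have "z \<in> {p..q} \<or> z = y"
      using that yi c(3,4) by (auto simp: min_def max_def split: if_splits)
    then show ?thesis
      using b y by (auto simp: block_def)
  qed
  have occ: "occ ?B = occ A"
  proof -
    have "(i, \<sigma> - r) \<in> A" "\<sigma> - r \<noteq> r"
      using c r(2) \<sigma> by auto
    moreover have "(i, r) \<in> A"
      using c r(2) by auto
    ultimately show ?thesis
      by (intro occ_remove_double[of _ _ "(i, \<sigma> - r)"]) auto
  qed
  have "seed \<sigma> ?B j j'"
    using c r y(2) yi \<sigma> unfolding seed_def j_def j'_def by auto
  moreover have "j \<in> {min p y..max q y}" "j' \<in> {min p y..max q y}"
    using c(3,4) by (auto simp: j_def j'_def)
  moreover have "min p y \<in> occ ?B" "max q y \<in> occ ?B"
    unfolding occ using b y(1) by (auto simp: block_def min_def max_def)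
  ultimately have "block \<sigma> ?B (min p y) (max q y) j j'"
    using free unfolding block_def by blast
  moreover have "{p..q} \<subseteq> {min p y..max q y}"
    by auto
  ultimately have "{p..q} \<subseteq> blocked \<sigma> ?B"
    using blockedI[of \<sigma> ?B "min p y" "max q y" j j'] by blast
  then show ?thesis
    using r(2) by blast
qed

lemma min_spans_three_rows_bound:
  assumes m: "m \<ge> 1" and min: "min_spans (strip m {-1..1}) A"
  shows "3 * int (card A) \<le> 2 * m + 6"
proof -
  have A: "A \<subseteq> strip m {-1..1}"
    using min by (simp add: min_spans_def spans_def)
  have sp: "spans (strip m {-1..1}) A"
    using min by (simp add: min_spans_def)
  have fin: "finite A"
    using A by (rule finite_subset) (simp add: strip_def)
  have d: "dense_cols m A"
    using spans_dense_cols[OF sp m] by simp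
  have fA: "filling A"
    by (rule spans_filling[OF sp m])
  have cols: "1 \<le> x \<and> x \<le> m" if "x \<in> occ A" for x
    using that A by (auto simp: occ_iff strip_def)
  have rows: "s = -1 \<or> s = 0 \<or> s = 1" if "(x, s) \<in> A" for x s
    using that A by (auto simp: strip_def)
  have rows\<sigma>: "s = 0 \<or> s = \<sigma> \<or> s = -\<sigma>" if "\<sigma> = -1 \<or> \<sigma> = 1" "(x, s) \<in> A" for x s \<sigma>
    using rows[OF that(2)] that(1) by auto
  have red: "\<not> filling B" if "B \<subset> A" "dense_cols m B" for B
    using that min filling_spans[of B m] A by (auto simp: min_spans_def)
  have red_cell: "\<not> filling (A - {w})" if "w \<in> A" "v \<in> A" "fst w = fst v" "w \<noteq> v" for v w
    using red[of "A - {w}"] dense_cols_remove_double[OF d that] that(1) by blast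
  have red_col: "\<not> filling (del_col A j)" if "j \<in> occ A" "j - 1 \<in> occ A" "j + 1 \<in> occ A" for j
    using red[OF del_col_psubset[OF that(1)]] dense_cols_del_col[OF d that(2,3)] by blast
  have del_col_iff: "(x, s) \<in> del_col A j \<longleftrightarrow> (x, s) \<in> A \<and> x \<noteq> j" for x s j
    by (auto simp: del_col_def)
  have "3 * int (card A) \<le> 2 * m + 2 + int 4"
  proof (cases "\<exists>x. (x, 1) \<in> A \<and> (x, -1) \<in> A")
    case True
    then obtain x where x: "(x, 1) \<in> A" "(x, -1) \<in> A" by blast
    have f: "filling B" if "(x, 1) \<in> B" "(x, -1) \<in> B" for B
      using fillingI(1)[of 1 x B] that by simp
    have inj: "inj_on fst (A - {(x, 1)})"
    proof (rule inj_on_fstI, rule ccontr)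
      fix z s r assume h: "(z, s) \<in> A - {(x, 1)}" "(z, r) \<in> A - {(x, 1)}" "s \<noteq> r"
      have nf: "\<not> filling (A - {(z, s)})" "\<not> filling (A - {(z, r)})"
        using h red_cell[of "(z, s)" "(z, r)"] red_cell[of "(z, r)" "(z, s)"] by auto
      have "(z, s) \<noteq> (x, -1) \<or> (z, r) \<noteq> (x, -1)"
        using h by auto
      then show False
        using nf f[of "A - {(z, s)}"] f[of "A - {(z, r)}"] x h by auto
    qed
    have window: "j = x" if "j \<in> occ A" "j - 1 \<in> occ A" "j + 1 \<in> occ A" for j
      using red_col[OF that] f[of "del_col A j"] x by (auto simp: del_col_iff)
    show ?thesis
      by (rule card_strip_bound[OF A _ inj, where X = "{x}" and I = "{}"])
         (use m window in auto)
  next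
    case False
    have n1: "\<not> ((x, \<sigma>) \<in> A \<and> (x, -\<sigma>) \<in> A)" if "\<sigma> = -1 \<or> \<sigma> = 1" for x \<sigma>
      using False that by auto
    have pairs: "(s = 0 \<or> r = 0) \<and> (z, 0) \<in> A \<and> (\<exists>\<tau>. (\<tau> = -1 \<or> \<tau> = 1) \<and> (z, \<tau>) \<in> A)"
      if "(z, s) \<in> A" "(z, r) \<in> A" "s \<noteq> r" for z s r
      using that rows[of z s] rows[of z r] n1[of 1 z] by auto
    show ?thesis
    proof (cases "\<exists>\<sigma> x. (\<sigma> = -1 \<or> \<sigma> = 1) \<and> (x - 1, \<sigma>) \<in> A \<and> (x + 1, \<sigma>) \<in> A \<and> (x, -\<sigma>) \<in> A")
      case True
      then obtain \<sigma> x where \<sigma>: "\<sigma> = -1 \<or> \<sigma> = 1"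
        and x: "(x - 1, \<sigma>) \<in> A" "(x + 1, \<sigma>) \<in> A" "(x, -\<sigma>) \<in> A" by blast
      have f: "filling B" if "(x - 1, \<sigma>) \<in> B" "(x + 1, \<sigma>) \<in> B" "(x, -\<sigma>) \<in> B" for B
        by (rule fillingI(2)[OF \<sigma>]) (use that in auto)
      have inj: "inj_on fst (A - {})"
      proof (rule inj_on_fstI, rule ccontr)
        fix z s r assume h: "(z, s) \<in> A - {}" "(z, r) \<in> A - {}" "s \<noteq> r"
        then obtain \<tau> where "(z, 0) \<in> A" "(z, \<tau>) \<in> A" "\<tau> = -1 \<or> \<tau> = 1"
          using pairs[of z s r] by auto
        then show False
          using red_cell[of "(z, 0)" "(z, \<tau>)"] f[of "A - {(z, 0)}"] x \<sigma> by auto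
      qed
      have window: "j \<in> {x - 1, x, x + 1}" if "j \<in> occ A" "j - 1 \<in> occ A" "j + 1 \<in> occ A" for j
        using red_col[OF that] f[of "del_col A j"] x by (auto simp: del_col_iff)
      show ?thesis
        by (rule card_strip_bound[OF A _ inj, where X = "{x - 1, x, x + 1}" and I = "{}"])
           (use m window in auto)
    next
      case False
      have n2: False if "\<sigma> = -1 \<or> \<sigma> = 1" "(y, \<sigma>) \<in> A" "(2 * x - y, \<sigma>) \<in> A" "\<bar>x - y\<bar> = 1"
        "(x, -\<sigma>) \<in> A" for \<sigma> x y
      proof -
        have "y = x - 1 \<or> y = x + 1" using that(4) by linarith
        then have "(x - 1, \<sigma>) \<in> A \<and> (x + 1, \<sigma>) \<in> A"
          using that(2,3) by (auto simp: algebra_simps)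
        then show False using False that by blast
      qed
      show ?thesis
      proof (cases "\<exists>\<sigma> i y. (\<sigma> = -1 \<or> \<sigma> = 1) \<and> (i, \<sigma>) \<in> A \<and> (i, 0) \<in> A \<and> (y, -\<sigma>) \<in> A \<and> \<bar>i - y\<bar> = 1")
        case True
        then obtain \<sigma> i y where \<sigma>: "\<sigma> = -1 \<or> \<sigma> = 1"
          and i: "(i, \<sigma>) \<in> A" "(i, 0) \<in> A" "(y, -\<sigma>) \<in> A" "\<bar>i - y\<bar> = 1" by blast
        have i_free: "(i, -\<sigma>) \<notin> A"
          using n1[OF \<sigma>, of i] i by auto
        have f: "filling B" if "(i, \<sigma>) \<in> B" "(i, 0) \<in> B" "(y, -\<sigma>) \<in> B" "B \<subseteq> A" for B
        proof -
          have "block \<sigma> B i i i i"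
            using that i_free by (auto simp: block_def seed_def occ_iff)
          then have "i \<in> blocked \<sigma> B"
            by (rule blockedI) simp
          then show ?thesis
            using fillingI(3)[OF \<sigma>] i(4) that(3) by blast
        qed
        have inj: "inj_on fst (A - {(i, 0)})"
        proof (rule inj_on_fstI, rule ccontr)
          fix z s r assume h: "(z, s) \<in> A - {(i, 0)}" "(z, r) \<in> A - {(i, 0)}" "s \<noteq> r"
          then obtain \<tau> where "(z, 0) \<in> A" "(z, \<tau>) \<in> A" "\<tau> = -1 \<or> \<tau> = 1" "z \<noteq> i"
            using pairs[of z s r] by auto
          then show False
            using red_cell[of "(z, 0)" "(z, \<tau>)"] f[of "A - {(z, 0)}"] i \<sigma> by auto
        qed
        have other: "2 * i - y \<notin> occ A"
        proof
          assume z: "2 * i - y \<in> occ A"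
          have zf: "(2 * i - y, -\<sigma>) \<notin> A"
            using n2[of "-\<sigma>" y i] \<sigma> i by auto
          have "block \<sigma> A i i i i"
            using i i_free by (auto simp: block_def seed_def occ_iff)
          then obtain r where r: "r = 0 \<or> r = \<sigma>" "{i..i} \<subseteq> blocked \<sigma> (A - {(i, r)})"
            using block_swap[of \<sigma> A i i i "2 * i - y"] z zf i(4) rows\<sigma>[OF \<sigma>] \<sigma> by force
          then have "filling (A - {(i, r)})"
            using fillingI(3)[OF \<sigma>, of i "A - {(i, r)}" y] i \<sigma> by auto
          moreover have "\<not> filling (A - {(i, r)})"
            using red_cell[of "(i, r)" "(i, \<sigma> - r)"] r(1) i \<sigma> by auto
          ultimately show False by blast
        qed
        have window: "j \<in> {y}" if w: "j \<in> occ A" "j - 1 \<in> occ A" "j + 1 \<in> occ A" for j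
        proof (rule ccontr)
          assume "j \<notin> {y}"
          moreover have "j \<noteq> i"
          proof
            assume "j = i"
            moreover have "y = i + 1 \<or> y = i - 1" using i(4) by linarith
            ultimately show False using other w by auto
          qed
          ultimately have "filling (del_col A j)"
            by (intro f) (use i in \<open>auto simp: del_col_def\<close>)
          then show False using red_col[OF w] by blast
        qed
        show ?thesis
          by (rule card_strip_bound[OF A _ inj, where X = "{y}" and I = "{}"])
             (use m window in auto)
      next
        case False
        have n3: "(y, -\<sigma>) \<notin> A" if "\<sigma> = -1 \<or> \<sigma> = 1" "block \<sigma> A p q i i" "\<bar>i - y\<bar> = 1" for \<sigma> p q i y
          using False that unfolding block_def seed_def by blast
        have swap: "\<exists>r. (r = 0 \<or> r = \<sigma>) \<and> {p..q} \<subseteq> blocked \<sigma> (A - {(i, r)}) \<and> \<not> filling (A - {(i, r)})"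
          if \<sigma>: "\<sigma> = -1 \<or> \<sigma> = 1" and b: "block \<sigma> A p q i i" and y: "\<bar>i - y\<bar> = 1" "y \<in> occ A" for \<sigma> p q i y
        proof -
          obtain r where r: "r = 0 \<or> r = \<sigma>" "{p..q} \<subseteq> blocked \<sigma> (A - {(i, r)})"
            using block_swap[OF b y(2,1) n3[OF \<sigma> b y(1)]] rows\<sigma>[OF \<sigma>] \<sigma> by force
          have "(i, \<sigma>) \<in> A" "(i, 0) \<in> A"
            using b by (auto simp: block_def seed_def)
          then have "\<not> filling (A - {(i, r)})"
            using red_cell[of "(i, r)" "(i, \<sigma> - r)"] r(1) \<sigma> by auto
          then show ?thesis using r by blast
        qed
        show ?thesis
        proof (cases "\<exists>\<sigma> x y. (\<sigma> = -1 \<or> \<sigma> = 1) \<and> x \<in> blocked \<sigma> A \<and> \<bar>x - y\<bar> = 1 \<and> (y, -\<sigma>) \<in> A")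
          case True
          then obtain \<sigma> x y p q i i' where \<sigma>: "\<sigma> = -1 \<or> \<sigma> = 1" and y: "\<bar>x - y\<bar> = 1" "(y, -\<sigma>) \<in> A"
            and x: "x \<in> {p..q}" and b: "block \<sigma> A p q i i'"
            unfolding blocked_def by blast
          have f: "filling B" if "x \<in> blocked \<sigma> B" "(y, -\<sigma>) \<in> B" for B
            using fillingI(3)[OF \<sigma> that(1) y(1) that(2)] .
          have bb: "i \<in> {p..q}" "i' \<in> {p..q}" "(i, \<sigma>) \<in> A" "(i', 0) \<in> A" "i \<in> occ A" "i' \<in> occ A"
            using b by (auto simp: block_def seed_def occ_iff)
          have double: False if h: "(z, 0) \<in> A" "(z, \<tau>) \<in> A" "\<tau> = -1 \<or> \<tau> = 1" "z \<noteq> i \<or> i \<noteq> i'" for z \<tau>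
          proof (cases "z = i'")
            case True
            then have "(z, -\<sigma>) \<notin> A"
              using b bb by (auto simp: block_def)
            then have \<tau>: "\<tau> = \<sigma>"
              using h \<sigma> by auto
            have "block \<sigma> (A - {(z, \<sigma>)}) p q i i'"
              using h True \<tau> \<sigma> by (intro block_remove[OF b, of _ "(z, 0)"]) auto
            then have "filling (A - {(z, \<sigma>)})"
              using blockedI x y \<sigma> by (intro f) auto
            then show False
              using red_cell[of "(z, \<sigma>)" "(z, 0)"] h \<tau> by auto
          next
            case False
            have "block \<sigma> (A - {(z, 0)}) p q i i'"
              using h False \<sigma> by (intro block_remove[OF b, of _ "(z, \<tau>)"]) auto
            then have "filling (A - {(z, 0)})"
              using blockedI x y \<sigma> by (intro f) auto
            then show False
              using red_cell[of "(z, 0)" "(z, \<tau>)"] h by auto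
          qed
          have window: "j \<in> {i, i', x, y}" if w: "j \<in> occ A" "j - 1 \<in> occ A" "j + 1 \<in> occ A" for j
          proof (rule ccontr)
            assume "j \<notin> {i, i', x, y}"
            then have "filling (del_col A j)"
              using blocked_del_col[OF b _ _ w(2,3) x] y by (intro f) (auto simp: del_col_iff)
            then show False using red_col[OF w] by blast
          qed
          show ?thesis
          proof (cases "i = i'")
            case False
            have inj: "inj_on fst (A - {})"
              by (rule inj_on_fstI) (use pairs double False in blast)
            show ?thesis
              by (rule card_strip_bound[OF A _ inj, where X = "{i, i', x, y}" and I = "{}"])
                 (use m window in \<open>auto simp: card_insert_if\<close>)
          next
            case True
            have iso: "z \<notin> occ A" if z: "\<bar>i - z\<bar> = 1" for z
            proof
              assume "z \<in> occ A"
              then obtain r where r: "r = 0 \<or> r = \<sigma>" "{p..q} \<subseteq> blocked \<sigma> (A - {(i, r)})"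
                "\<not> filling (A - {(i, r)})"
                using swap[OF \<sigma> _ z] b True by blast
              then show False
                using f[of "A - {(i, r)}"] x y \<sigma> by auto
            qed
            have iso': "i - 1 \<notin> occ A" "i + 1 \<notin> occ A"
              using iso[of "i - 1"] iso[of "i + 1"] by auto
            have inj: "inj_on fst (A - {(i, 0)})"
            proof (rule inj_on_fstI, rule ccontr)
              fix z s r assume h: "(z, s) \<in> A - {(i, 0)}" "(z, r) \<in> A - {(i, 0)}" "s \<noteq> r"
              then obtain \<tau> where "(z, 0) \<in> A" "(z, \<tau>) \<in> A" "\<tau> = -1 \<or> \<tau> = 1" "z \<noteq> i"
                using pairs[of z s r] by auto
              then show False using double by blast
            qed
            have window': "j \<in> {x, y}" if w: "j \<in> occ A" "j - 1 \<in> occ A" "j + 1 \<in> occ A" for j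
              using window[OF w] w iso' True by auto
            show ?thesis
              by (rule card_strip_bound[OF A _ inj, where X = "{x, y}" and I = "{i}"])
                 (use m window' iso' bb in \<open>auto simp: card_insert_if\<close>)
          qed
        next
          case False
          have n4: "(y, -\<sigma>) \<notin> A" if "\<sigma> = -1 \<or> \<sigma> = 1" "x \<in> blocked \<sigma> A" "\<bar>x - y\<bar> = 1" for \<sigma> x y
            using False that by blast
          have main: ?thesis
            if \<sigma>: "\<sigma> = -1 \<or> \<sigma> = 1" and b: "block \<sigma> A p q i i'" and b': "block (-\<sigma>) A p' q' k k'"
              and xy: "x \<in> {p..q}" "y \<in> {p'..q'}" "\<bar>x - y\<bar> \<le> 2" and ik: "i < k"
            for \<sigma> p q i i' p' q' k k' x y
          proof -
            have \<sigma>': "-\<sigma> = -1 \<or> -\<sigma> = 1" using \<sigma> by auto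
            have bb: "i \<in> {p..q}" "i' \<in> {p..q}" "(i, \<sigma>) \<in> A" "(i', 0) \<in> A" "i \<in> occ A" "i' \<in> occ A"
              "p \<in> occ A" "q \<in> occ A" "\<bar>i - i'\<bar> \<le> 1"
              using b by (auto simp: block_def seed_def occ_iff)
            have kk: "k \<in> {p'..q'}" "k' \<in> {p'..q'}" "(k, -\<sigma>) \<in> A" "(k', 0) \<in> A" "k \<in> occ A" "k' \<in> occ A"
              "p' \<in> occ A" "q' \<in> occ A" "\<bar>k - k'\<bar> \<le> 1"
              using b' by (auto simp: block_def seed_def occ_iff)
            define Y where "Y = {z. (z, -\<sigma>) \<in> A \<and> i < z}"
            define t where "t = Min Y"
            have "Y \<subseteq> occ A" by (auto simp: Y_def occ_iff)
            then have finY: "finite Y"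
              using fin finite_subset by (fastforce simp: occ_def)
            have kY: "k \<in> Y" using kk ik by (simp add: Y_def)
            then have tY: "t \<in> Y"
              using Min_in[OF finY] by (auto simp: t_def)
            have tk: "t \<le> k" using Min_le[OF finY kY] by (simp add: t_def)
            have t: "(t, -\<sigma>) \<in> A" "i < t" "t \<in> occ A"
              using tY by (auto simp: Y_def occ_iff)
            have free: "(z, -\<sigma>) \<notin> A" if "z \<in> {p..t - 1}" for z
            proof (cases "z \<le> i")
              case True
              then show ?thesis using b that bb(1) by (auto simp: block_def)
            next
              case False
              have "z \<notin> Y" using Min_le[OF finY, of z] that by (auto simp: t_def)
              then show ?thesis using False by (simp add: Y_def)
            qed
            have qt: "q < t"
            proof (rule ccontr)
              assume "\<not> q < t"
              then have "t \<in> {p..q}" using t bb(1) by auto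
              then show False using b t by (auto simp: block_def)
            qed
            have gap: "t - 1 \<notin> occ A"
            proof
              assume "t - 1 \<in> occ A"
              then have "block \<sigma> A p (t - 1) i i'"
                using b bb qt free by (auto simp: block_def)
              then have "t - 1 \<in> blocked \<sigma> A"
                by (rule blockedI) (use bb t in auto)
              then show False
                using n4[OF \<sigma>, of "t - 1" t] t by auto
            qed
            have ne: "i \<noteq> t - 1" "i' \<noteq> t - 1" "k' \<noteq> t - 1" "q \<noteq> t - 1"
              using gap bb kk by auto
            have t2: "t - 2 \<in> occ A"
              using d[unfolded dense_cols_def, rule_format, of "t - 2"] gap cols[OF t(3)]
                cols[OF bb(5)] t(2) ne by auto
            have B1: "block \<sigma> A p (t - 2) i i'"
              using b bb qt free t2 ne by (auto simp: block_def)
            have "p' \<le> t"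
              using xy qt ne by auto
            then have B2: "block (-\<sigma>) A t q' k k'"
              using b' kk t tk ne by (auto simp: block_def)
            have f: "filling B" if "t - 2 \<in> blocked \<sigma> B" "t \<in> blocked (-\<sigma>) B" for B
              using fillingI(4)[OF \<sigma> that(1) _ that(2)] by simp
            have in1: "t - 2 \<in> {p..t - 2}" and in2: "t \<in> {t..q'}"
              using B1 B2 by (auto simp: block_def)
            have le: "i \<le> t - 2" "i' \<le> t - 2" "t \<le> k" "t \<le> k'"
              using B1 B2 by (auto simp: block_def)
            have double: False if h: "(z, 0) \<in> A" "(z, \<tau>) \<in> A" "\<tau> = -1 \<or> \<tau> = 1"
              "z \<noteq> i \<or> i \<noteq> i'" "z \<noteq> k \<or> k \<noteq> k'" for z \<tau>
            proof -
              define w where "w = (z, if z = i' then \<sigma> else if z = k' then -\<sigma> else 0)"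
              define v where "v = (z, if z = i' \<or> z = k' then 0 else \<tau>)"
              have "\<tau> = \<sigma>" if "z = i'"
              proof -
                have "(z, -\<sigma>) \<notin> A" using that b bb by (auto simp: block_def)
                then show ?thesis using h \<sigma> by auto
              qed
              moreover have "\<tau> = -\<sigma>" if "z = k'"
              proof -
                have "(z, \<sigma>) \<notin> A" using that b' kk by (auto simp: block_def)
                then show ?thesis using h \<sigma> by auto
              qed
              ultimately have wv: "w \<in> A" "v \<in> A" "fst w = fst v" "w \<noteq> v"
                using h \<sigma> le by (auto simp: w_def v_def)
              have ne: "w \<noteq> (i, \<sigma>)" "w \<noteq> (i', 0)" "w \<noteq> (k, -\<sigma>)" "w \<noteq> (k', 0)"
                using h(4,5) \<sigma> le by (auto simp: w_def)
              have "filling (A - {w})"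
                using blockedI[OF block_remove[OF B1 wv ne(1,2)] in1]
                  blockedI[OF block_remove[OF B2 wv ne(3,4)] in2] by (rule f)
              then show False
                using red_cell[OF wv] by blast
            qed
            have window: "j = i \<or> j = i' \<or> j = k \<or> j = k'"
              if w: "j \<in> occ A" "j - 1 \<in> occ A" "j + 1 \<in> occ A" for j
            proof (rule ccontr)
              assume n: "\<not> ?thesis"
              have jt: "t - 2 \<noteq> j" "t \<noteq> j" using w gap by auto
              have "filling (del_col A j)"
                using blocked_del_col[OF B1 _ _ w(2,3) in1 jt(1)] blocked_del_col[OF B2 _ _ w(2,3) in2 jt(2)] n
                by (intro f) auto
              then show False using red_col[OF w] by blast
            qed
            have iso1: "z \<notin> occ A" if e: "i = i'" and z: "\<bar>i - z\<bar> = 1" for z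
            proof
              assume "z \<in> occ A"
              then obtain r where r: "r = 0 \<or> r = \<sigma>" "{p..t - 2} \<subseteq> blocked \<sigma> (A - {(i, r)})"
                "\<not> filling (A - {(i, r)})"
                using swap[OF \<sigma> _ z] B1 e by blast
              have "(i, r) \<in> A" "(i, \<sigma> - r) \<in> A"
                using r(1) bb(3,4) e by auto
              moreover have "(i, r) \<noteq> (i, \<sigma> - r)"
                using r(1) \<sigma> by (elim disjE) simp_all
              moreover have "i \<noteq> k" "i \<noteq> k'"
                using le by linarith+
              then have "(i, r) \<noteq> (k, -\<sigma>)" "(i, r) \<noteq> (k', 0)"
                by simp_all
              ultimately have "block (-\<sigma>) (A - {(i, r)}) t q' k k'"
                using block_remove[OF B2] by (metis fst_conv)
              then show False
                using f[of "A - {(i, r)}"] r(2,3) in1 blockedI[OF _ in2] by blast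
            qed
            have iso2: "z \<notin> occ A" if e: "k = k'" and z: "\<bar>k - z\<bar> = 1" for z
            proof
              assume "z \<in> occ A"
              then obtain r where r: "r = 0 \<or> r = -\<sigma>" "{t..q'} \<subseteq> blocked (-\<sigma>) (A - {(k, r)})"
                "\<not> filling (A - {(k, r)})"
                using swap[OF \<sigma>' _ z] B2 e by blast
              have "(k, r) \<in> A" "(k, -\<sigma> - r) \<in> A"
                using r(1) kk(3,4) e by auto
              moreover have "(k, r) \<noteq> (k, -\<sigma> - r)"
                using r(1) \<sigma> by (elim disjE) simp_all
              moreover have "k \<noteq> i" "k \<noteq> i'"
                using le by linarith+
              then have "(k, r) \<noteq> (i, \<sigma>)" "(k, r) \<noteq> (i', 0)"
                by simp_all
              ultimately have "block \<sigma> (A - {(k, r)}) p (t - 2) i i'"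
                using block_remove[OF B1] by (metis fst_conv)
              then show False
                using f[of "A - {(k, r)}"] r(2,3) in2 blockedI[OF _ in1] by blast
            qed
            define E where "E = (if i = i' then {(i, 0 :: int)} else {}) \<union> (if k = k' then {(k, 0)} else {})"
            define X where "X = (if i = i' then {} else {i, i'}) \<union> (if k = k' then {} else {k, k'})"
            define I where "I = (if i = i' then {i} else {}) \<union> (if k = k' then {k} else {})"
            have inj: "inj_on fst (A - E)"
            proof (rule inj_on_fstI, rule ccontr)
              fix z s r assume h: "(z, s) \<in> A - E" "(z, r) \<in> A - E" "s \<noteq> r"
              then obtain \<tau> where \<tau>: "(z, 0) \<in> A" "(z, \<tau>) \<in> A" "\<tau> = -1 \<or> \<tau> = 1"
                and "s = 0 \<or> r = 0"
                using pairs[of z s r] by auto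
              then have "(z, 0) \<notin> E" using h by auto
              then have "z \<noteq> i \<or> i \<noteq> i'" "z \<noteq> k \<or> k \<noteq> k'"
                by (auto simp: E_def)
              then show False using double \<tau> by blast
            qed
            have isoI: "j \<in> occ A \<and> j - 1 \<notin> occ A \<and> j + 1 \<notin> occ A" if "j \<in> I" for j
              using that bb(5) kk(5) iso1[of "i - 1"] iso1[of "i + 1"] iso2[of "k - 1"] iso2[of "k + 1"]
              by (auto simp: I_def split: if_splits)
            have winX: "j \<in> X" if w: "j \<in> occ A" "j - 1 \<in> occ A" "j + 1 \<in> occ A" for j
            proof -
              have "j \<notin> I" using isoI w by blast
              then show ?thesis using window[OF w] by (auto simp: X_def I_def split: if_splits)
            qed
            have "card X + 3 * card E \<le> 4 + card I"
              using le ik by (auto simp: X_def E_def I_def card_insert_if)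
            then show ?thesis
              by (intro card_strip_bound[OF A _ inj, of X I])
                 (use m winX isoI in \<open>auto simp: X_def E_def\<close>)
          qed
          show ?thesis
            using fA
          proof (cases rule: fillingE)
            case (opposite \<sigma> x y)
            then obtain p q i i' p' q' k k' where b: "x \<in> {p..q}" "block \<sigma> A p q i i'"
              "y \<in> {p'..q'}" "block (-\<sigma>) A p' q' k k'"
              unfolding blocked_def by blast
            have "i \<noteq> k"
              using b n1[OF opposite(1), of i] by (auto simp: block_def seed_def)
            then consider "i < k" | "k < i" by linarith
            then show ?thesis
            proof cases
              case 1
              then show ?thesis using main[OF opposite(1) b(2,4,1,3)] opposite by blast
            next
              case 2
              have "-\<sigma> = -1 \<or> -\<sigma> = 1" "block (- (-\<sigma>)) A p q i i'" "\<bar>y - x\<bar> \<le> 2"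
                using opposite b by auto
              then show ?thesis using main[of "-\<sigma>" p' q' k k' p q i i' y x] b 2 by blast
            qed
          next
            case (outer \<sigma> x)
            then show ?thesis using n1 by blast
          next
            case (gap \<sigma> x)
            then show ?thesis using n2[of \<sigma> "x - 1" x] by (simp add: algebra_simps)
          next
            case (cell \<sigma> x y)
            then show ?thesis using n4 by blast
          qed
        qed
      qed
    qed
  qed
  then show ?thesis
    by simp
qed

subsection \<open>Large minimal sets\<close>

definition tail :: "int \<Rightarrow> int \<Rightarrow> (int \<times> int) set" where
  "tail a m = {j. a < j \<and> j \<le> m \<and> (j - a) mod 3 \<noteq> 1} \<times> {0}"

lemma tail_card:
  fixes k :: nat
  shows "finite (tail a (a + 3 * int k)) \<and> card (tail a (a + 3 * int k)) = 2 * k"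
proof (induction k)
  case 0
  have "tail a (a + 3 * int 0) = {}"
    by (auto simp: tail_def)
  then show ?case
    by simp
next
  case (Suc k)
  let ?T = "tail a (a + 3 * int k)"
  let ?u = "(a + 3 * int k + 2, 0)" and ?v = "(a + 3 * int k + 3, 0)"
  have split: "j \<le> a + 3 * int (Suc k) \<longleftrightarrow>
      j \<le> a + 3 * int k \<or> j = a + 3 * int k + 1 \<or> j = a + 3 * int k + 2 \<or> j = a + 3 * int k + 3" for j
    by auto
  have "(3 * int k + 1) mod 3 = 1" "(3 * int k + 2) mod 3 = 2" "(3 * int k + 3) mod 3 = 0"
    by presburger+
  then have "tail a (a + 3 * int (Suc k)) = insert ?u (insert ?v ?T)"
    unfolding tail_def split by (auto simp: algebra_simps)
  moreover have "?u \<notin> ?T" "?v \<notin> ?T"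
    by (auto simp: tail_def)
  ultimately show ?case
    using Suc by simp
qed

lemma occ_tail:
  "x \<in> occ (b \<union> tail a m) \<longleftrightarrow> x \<in> occ b \<or> a < x \<and> x \<le> m \<and> (x - a) mod 3 \<noteq> 1"
  by (auto simp: occ_iff tail_def)

lemma dense_cols_tail_iff:
  fixes k :: nat
  assumes b: "b \<subseteq> strip a H" and a: "a \<ge> 1" and m: "m = a + 3 * int k"
  shows "dense_cols m (b \<union> tail a m) \<longleftrightarrow> dense_cols a b"
proof
  {
    assume d: "dense_cols m (b \<union> tail a m)"
    show "dense_cols a b"
      unfolding dense_cols_def
    proof (intro allI impI)
      fix x assume x: "0 \<le> x" "x \<le> a"
      then have "x \<in> occ (b \<union> tail a m) \<or> x + 1 \<in> occ (b \<union> tail a m)"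
        using d m by (auto simp: dense_cols_def)
      moreover have "\<not> (a < x + 1 \<and> x + 1 \<le> m \<and> (x + 1 - a) mod 3 \<noteq> 1)"
      proof
        assume h: "a < x + 1 \<and> x + 1 \<le> m \<and> (x + 1 - a) mod 3 \<noteq> 1"
        then have "x + 1 - a = 1" using x by auto
        then show False using h by simp
      qed
      ultimately show "x \<in> occ b \<or> x + 1 \<in> occ b"
        using x unfolding occ_tail by auto
    qed
  next
    assume d: "dense_cols a b"
    show "dense_cols m (b \<union> tail a m)"
      unfolding dense_cols_def
    proof (intro allI impI)
      fix x assume x: "0 \<le> x" "x \<le> m"
      show "x \<in> occ (b \<union> tail a m) \<or> x + 1 \<in> occ (b \<union> tail a m)"
      proof (cases "x \<le> a")
        case True
        then show ?thesis using d x by (auto simp: dense_cols_def occ_tail)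
      next
        case False
        have "(x - a) mod 3 \<noteq> 1 \<or> (x + 1 - a) mod 3 \<noteq> 1 \<and> x + 1 \<le> m"
          using x m False by presburger
        then show ?thesis using False x by (auto simp: occ_tail)
      qed
    qed
  }
qed

lemma not_dense_cols_tail_remove:
  fixes k :: nat
  assumes b: "b \<subseteq> strip a H" and a: "a \<ge> 1" and m: "m = a + 3 * int k" and v: "v \<in> tail a m"
  shows "\<not> dense_cols m (b \<union> tail a m - {v})"
proof
  assume d: "dense_cols m (b \<union> tail a m - {v})"
  obtain j where j: "v = (j, 0)" "a < j" "j \<le> m" "(j - a) mod 3 \<noteq> 1"
    using v by (auto simp: tail_def)
  have occb: "x \<le> a" if "(x, s) \<in> b" for x s
    using that b by (auto simp: strip_def)
  have occ: "x \<le> a \<or> x \<noteq> j \<and> x \<le> m \<and> (x - a) mod 3 \<noteq> 1" if "x \<in> occ (b \<union> tail a m - {v})" for x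
    using that occb j by (auto simp: occ_iff tail_def)
  show False
  proof (cases "(j - a) mod 3 = 2")
    case True
    then have "(j - 1 - a) mod 3 = 1" "j - 1 > a"
      using j by presburger+
    then show False
      using d[unfolded dense_cols_def, rule_format, of "j - 1"] occ[of "j - 1"] occ[of j] j a by auto
  next
    case False
    then have "(j + 1 - a) mod 3 = 1"
      using j by presburger
    then show False
      using d[unfolded dense_cols_def, rule_format, of j] occ[of "j + 1"] occ[of j] j a by auto
  qed
qed

lemma spans_mono: "spans R B \<Longrightarrow> B \<subseteq> A \<Longrightarrow> A \<subseteq> R \<Longrightarrow> spans R A"
  unfolding spans_def by blast

lemma min_spans_tail:
  fixes k :: nat
  assumes b: "b \<subseteq> strip a H" and a: "a \<ge> 1" and m: "m = a + 3 * int k" and H: "0 \<in> H"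
    and sp: "spans (strip m H) (b \<union> tail a m)"
    and ess: "\<And>v. v \<in> b \<Longrightarrow> \<not> spans (strip m H) (b - {v} \<union> tail a m)"
    and fin: "finite b"
  shows "\<exists>B. min_spans (strip m H) B \<and> card B = card b + 2 * k"
proof -
  have disj: "b \<inter> tail a m = {}"
    using b by (auto simp: strip_def tail_def)
  have "min_spans (strip m H) (b \<union> tail a m)"
    unfolding min_spans_def
  proof (intro conjI allI impI notI sp)
    fix B assume B: "B \<subset> b \<union> tail a m" "spans (strip m H) B"
    then obtain v where v: "v \<in> b \<union> tail a m" "v \<notin> B"
      by blast
    have "b \<union> tail a m - {v} \<subseteq> strip m H"
      using sp by (auto simp: spans_def)
    then have s: "spans (strip m H) (b \<union> tail a m - {v})"
      using B v by (intro spans_mono[OF B(2)]) auto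
    show False
    proof (cases "v \<in> b")
      case True
      then have "b \<union> tail a m - {v} = b - {v} \<union> tail a m"
        using disj by auto
      then show False
        using s ess[OF True] by simp
    next
      case False
      have "dense_cols m (b \<union> tail a m - {v})"
        using spans_dense_cols[OF s] a m H by auto
      then show False
        using not_dense_cols_tail_remove[OF b a m] v False by blast
    qed
  qed
  moreover have "card (b \<union> tail a m) = card b + 2 * k"
    using tail_card[of a k] disj fin m by (simp add: card_Un_disjoint)
  ultimately show ?thesis
    by blast
qed

lemma tail_subset_strip: "a \<ge> 1 \<Longrightarrow> 0 \<in> H \<Longrightarrow> tail a m \<subseteq> strip m H"
  by (auto simp: tail_def strip_def)

lemma strip_mono: "a \<le> m \<Longrightarrow> strip a H \<subseteq> strip m H"
  by (auto simp: strip_def)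

lemma dense_cols_small:
  "dense_cols 1 b \<longleftrightarrow> (\<forall>x\<in>{0, 1}. x \<in> occ b \<or> x + 1 \<in> occ b)"
  "dense_cols 2 b \<longleftrightarrow> (\<forall>x\<in>{0, 1, 2}. x \<in> occ b \<or> x + 1 \<in> occ b)"
  "dense_cols 3 b \<longleftrightarrow> (\<forall>x\<in>{0, 1, 2, 3}. x \<in> occ b \<or> x + 1 \<in> occ b)"
proof -
  have ball: "dense_cols a b \<longleftrightarrow> (\<forall>x\<in>{0..a}. x \<in> occ b \<or> x + 1 \<in> occ b)" for a
    by (auto simp: dense_cols_def)
  have "{0..1} = {0, 1 :: int}" "{0..2} = {0, 1, 2 :: int}" "{0..3} = {0, 1, 2, 3 :: int}"
    by auto
  then show "dense_cols 1 b \<longleftrightarrow> (\<forall>x\<in>{0, 1}. x \<in> occ b \<or> x + 1 \<in> occ b)"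
    "dense_cols 2 b \<longleftrightarrow> (\<forall>x\<in>{0, 1, 2}. x \<in> occ b \<or> x + 1 \<in> occ b)"
    "dense_cols 3 b \<longleftrightarrow> (\<forall>x\<in>{0, 1, 2, 3}. x \<in> occ b \<or> x + 1 \<in> occ b)"
    by (simp_all only: ball)
qed

lemma residue_cases:
  fixes m :: nat
  assumes "m \<ge> 1"
  obtains k where "m = 1 + 3 * k" | k where "m = 2 + 3 * k" | k where "m = 3 + 3 * k"
proof -
  have "m = 1 + 3 * ((m - 1) div 3) \<or> m = 2 + 3 * ((m - 1) div 3) \<or> m = 3 + 3 * ((m - 1) div 3)"
    using assms by presburger
  then show thesis
    using that by blast
qed

lemma one_row_tail:
  fixes c k :: nat
  assumes b: "b \<subseteq> strip a {0}" and a: "a \<ge> 1" and d: "dense_cols a b"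
    and ess: "\<forall>v\<in>b. \<not> dense_cols a (b - {v})" and fin: "finite b"
    and m: "m = a + 3 * int k" and c: "c = card b + 2 * k"
  shows "\<exists>B. min_spans (strip m {0}) B \<and> card B = c"
  unfolding c
proof (rule min_spans_tail[OF b a m _ _ _ fin])
  have iff: "spans (strip m {0}) (b' \<union> tail a m) \<longleftrightarrow> dense_cols a b'" if "b' \<subseteq> b" for b'
  proof -
    have b': "b' \<subseteq> strip a {0}" using that b by blast
    then have "b' \<union> tail a m \<subseteq> strip m {0}"
      using strip_mono[of a m] tail_subset_strip[OF a] m by (simp add: subset_trans)
    then show ?thesis
      using spans_one_row_iff[of m] dense_cols_tail_iff[OF b' a m] a m by simp
  qed
  show "spans (strip m {0}) (b \<union> tail a m)"
    using iff d by blast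
  show "\<not> spans (strip m {0}) (b - {v} \<union> tail a m)" if "v \<in> b" for v
    using iff[of "b - {v}"] ess that by blast
qed simp

lemma one_row_construction:
  fixes m :: nat
  assumes "m \<ge> 1"
  shows "\<exists>B. min_spans (strip (int m) {0}) B \<and> card B = (2 * m + 2) div 3"
  using assms
proof (cases rule: residue_cases)
  case (1 k)
  then have c: "(2 * m + 2) div 3 = 1 + 2 * k"
    by presburger
  show ?thesis
    unfolding c
    by (rule one_row_tail[where b = "{(1, 0)}" and a = 1 and k = k])
       (auto simp: 1 dense_cols_small occ_def strip_def insert_Diff_if)
next
  case (2 k)
  then have c: "(2 * m + 2) div 3 = 2 + 2 * k"
    by presburger
  show ?thesis
    unfolding c
    by (rule one_row_tail[where b = "{(1, 0), (2, 0)}" and a = 2 and k = k])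
       (auto simp: 2 dense_cols_small occ_def strip_def insert_Diff_if)
next
  case (3 k)
  then have c: "(2 * m + 2) div 3 = 2 + 2 * k"
    by presburger
  show ?thesis
    unfolding c
    by (rule one_row_tail[where b = "{(1, 0), (3, 0)}" and a = 3 and k = k])
       (auto simp: 3 dense_cols_small occ_def strip_def insert_Diff_if)
qed

lemma two_rows_tail:
  fixes c k :: nat
  assumes b: "b \<subseteq> strip a {0..1}" and a: "a \<ge> 1" and d: "dense_cols a b" and s: "seed 1 b i i'"
    and ess: "\<forall>v\<in>b. \<not> dense_cols a (b - {v}) \<or> (\<forall>i i'. \<not> seed 1 (b - {v}) i i')"
    and fin: "finite b"
    and m: "m = a + 3 * int k" and c: "c = card b + 2 * k"
  shows "\<exists>B. min_spans (strip m {0..1}) B \<and> card B = c"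
  unfolding c
proof (rule min_spans_tail[OF b a m _ _ _ fin])
  have iff: "spans (strip m {0..1}) (b' \<union> tail a m) \<longleftrightarrow> dense_cols a b' \<and> (\<exists>i i'. seed 1 b' i i')"
    if "b' \<subseteq> b" for b'
  proof -
    have b': "b' \<subseteq> strip a {0..1}" using that b by blast
    then have "b' \<union> tail a m \<subseteq> strip m {0..1}"
      using strip_mono[of a m] tail_subset_strip[OF a] m by (simp add: subset_trans)
    moreover have "seed 1 (b' \<union> tail a m) i i' \<longleftrightarrow> seed 1 b' i i'" for i i'
    proof
      assume "seed 1 (b' \<union> tail a m) i i'"
      then have h: "(i, 1) \<in> b'" "(i', 0) \<in> b' \<or> (i', 0) \<in> tail a m" "\<bar>i - i'\<bar> \<le> 1"
        by (auto simp: seed_def tail_def)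
      have "(i', 0) \<notin> tail a m"
      proof
        assume "(i', 0) \<in> tail a m"
        then have t: "a < i'" "(i' - a) mod 3 \<noteq> 1" by (auto simp: tail_def)
        moreover have "i \<le> a" using h b' by (auto simp: strip_def)
        ultimately have "i' - a = 1" using h(3) by linarith
        then show False using t by simp
      qed
      then show "seed 1 b' i i'" using h by (auto simp: seed_def)
    qed (auto simp: seed_def)
    ultimately show ?thesis
      using spans_two_rows_iff[of m "b' \<union> tail a m"] dense_cols_tail_iff[OF b' a m] a m by auto
  qed
  show "spans (strip m {0..1}) (b \<union> tail a m)"
    using iff d s by blast
  show "\<not> spans (strip m {0..1}) (b - {v} \<union> tail a m)" if "v \<in> b" for v
    using iff[of "b - {v}"] ess that by blast
qed simp

lemma two_rows_construction:
  fixes m :: nat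
  assumes "m \<ge> 1"
  shows "\<exists>B. min_spans (strip (int m) {0..1}) B \<and> card B = (2 * m + 4) div 3"
  using assms
proof (cases rule: residue_cases)
  case (1 k)
  then have c: "(2 * m + 4) div 3 = 2 + 2 * k"
    by presburger
  show ?thesis
    unfolding c
    by (rule two_rows_tail[where b = "{(1, 0), (1, 1)}" and a = 1 and k = k and i = 1 and i' = 1])
       (auto simp: 1 dense_cols_small occ_def strip_def insert_Diff_if seed_def)
next
  case (2 k)
  then have c: "(2 * m + 4) div 3 = 2 + 2 * k"
    by presburger
  show ?thesis
    unfolding c
    by (rule two_rows_tail[where b = "{(1, 1), (2, 0)}" and a = 2 and k = k and i = 1 and i' = 2])
       (auto simp: 2 dense_cols_small occ_def strip_def insert_Diff_if seed_def)
next
  case (3 k)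
  then have c: "(2 * m + 4) div 3 = 3 + 2 * k"
    by presburger
  show ?thesis
    unfolding c
    by (rule two_rows_tail[where b = "{(1, 0), (2, 1), (3, 0)}" and a = 3 and k = k and i = 2 and i' = 1])
       (auto simp: 3 dense_cols_small occ_def strip_def insert_Diff_if seed_def)
qed

lemma three_rows_tail:
  fixes c k :: nat
  assumes b: "b \<subseteq> strip a {-1..1}" and a: "a \<ge> 1" and d: "dense_cols a b"
    and x: "(x, 1) \<in> b" "(x, -1) \<in> b"
    and ess: "\<forall>v\<in>b. \<not> dense_cols a (b - {v}) \<or> (\<exists>r\<in>{-1, 1}. \<forall>y. (y, r) \<notin> b - {v})"
    and fin: "finite b"
    and m: "m = a + 3 * int k" and c: "c = card b + 2 * k"
  shows "\<exists>B. min_spans (strip m {-1..1}) B \<and> card B = c"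
  unfolding c
proof (rule min_spans_tail[OF b a m _ _ _ fin])
  have sub: "b \<union> tail a m \<subseteq> strip m {-1..1}"
    using b strip_mono[of a m] tail_subset_strip[OF a] m by (simp add: subset_trans)
  have "filling (b \<union> tail a m)"
    using x by (intro fillingI(1)[of 1 x]) auto
  then show "spans (strip m {-1..1}) (b \<union> tail a m)"
    using filling_spans[OF sub] dense_cols_tail_iff[OF b a m] d by blast
  fix v assume v: "v \<in> b"
  show "\<not> spans (strip m {-1..1}) (b - {v} \<union> tail a m)"
  proof
    assume s: "spans (strip m {-1..1}) (b - {v} \<union> tail a m)"
    have m1: "m \<ge> 1" using a m by simp
    have "dense_cols m (b - {v} \<union> tail a m)"
      using spans_dense_cols[OF s m1] by simp
    then have "dense_cols a (b - {v})"
      using dense_cols_tail_iff[of "b - {v}" a _ m k] b a m by blast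
    then obtain r where r: "r \<in> {-1, 1 :: int}" "\<forall>y. (y, r) \<notin> b - {v}"
      using ess v by blast
    have "\<exists>y. (y, r) \<in> b - {v} \<union> tail a m"
      using r(1) by (intro spans_extreme_row[OF s m1]) auto
    then show False
      using r by (auto simp: tail_def)
  qed
qed simp

lemma three_rows_construction:
  fixes m :: nat
  assumes "m \<ge> 1"
  shows "\<exists>B. min_spans (strip (int m) {-1..1}) B \<and> card B = (2 * m + 6) div 3"
  using assms
proof (cases rule: residue_cases)
  case (1 k)
  then have c: "(2 * m + 6) div 3 = 2 + 2 * k"
    by presburger
  show ?thesis
    unfolding c
    by (rule three_rows_tail[where b = "{(1, 1), (1, -1)}" and a = 1 and k = k and x = 1])
       (auto simp: 1 dense_cols_small occ_def strip_def insert_Diff_if)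
next
  case (2 k)
  then have c: "(2 * m + 6) div 3 = 3 + 2 * k"
    by presburger
  show ?thesis
    unfolding c
    by (rule three_rows_tail[where b = "{(1, 1), (1, -1), (2, 0)}" and a = 2 and k = k and x = 1])
       (auto simp: 2 dense_cols_small occ_def strip_def insert_Diff_if)
next
  case (3 k)
  then have c: "(2 * m + 6) div 3 = 4 + 2 * k"
    by presburger
  show ?thesis
    unfolding c
    by (rule three_rows_tail[where b = "{(1, 0), (2, 1), (2, -1), (3, 0)}" and a = 3 and k = k and x = 2])
       (auto simp: 3 dense_cols_small occ_def strip_def insert_Diff_if)
qed

theorem theorem4p1:
  fixes m :: nat
  assumes "m \<ge> 1"
  shows "int (max_minimal_percolating m 1) = \<lfloor>2 * (real m + 1) / 3\<rfloor> \<and>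
         int (max_minimal_percolating m 2) = \<lfloor>2 * (real m + 2) / 3\<rfloor> \<and>
         int (max_minimal_percolating m 3) = \<lfloor>2 * (real m + 3) / 3\<rfloor>"
proof -
  have m: "int m \<ge> 1"
    using assms by simp
  have floor: "int ((2 * m + 2 * n) div 3) = \<lfloor>2 * (real m + real n) / 3\<rfloor>" for n
    using floor_divide_of_nat_eq[of "2 * m + 2 * n" 3, where 'a = real] by (simp add: algebra_simps)
  have "max_minimal_percolating m 1 = (2 * m + 2) div 3"
  proof (rule max_minimal_percolating_eqI[where c = 1])
    have H: "{1 - 1..int 1 - 1} = {0}" by simp
    show "\<exists>B. min_spans (strip (int m) {1 - 1..int 1 - 1}) B \<and> card B = (2 * m + 2) div 3"
      unfolding H using one_row_construction assms by blast
    fix B assume "min_spans (strip (int m) {1 - 1..int 1 - 1}) B"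
    then have "3 * int (card B) \<le> 2 * int m + 2"
      unfolding H using min_spans_one_row_bound m by blast
    then show "card B \<le> (2 * m + 2) div 3" by linarith
  qed
  moreover have "max_minimal_percolating m 2 = (2 * m + 4) div 3"
  proof (rule max_minimal_percolating_eqI[where c = 1])
    have H: "{1 - 1..int 2 - 1} = {0..1}" by simp
    show "\<exists>B. min_spans (strip (int m) {1 - 1..int 2 - 1}) B \<and> card B = (2 * m + 4) div 3"
      unfolding H using two_rows_construction assms by blast
    fix B assume "min_spans (strip (int m) {1 - 1..int 2 - 1}) B"
    then have "3 * int (card B) \<le> 2 * int m + 4"
      unfolding H using min_spans_two_rows_bound m by blast
    then show "card B \<le> (2 * m + 4) div 3" by linarith
  qed
  moreover have "max_minimal_percolating m 3 = (2 * m + 6) div 3"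
  proof (rule max_minimal_percolating_eqI[where c = 2])
    have H: "{1 - 2..int 3 - 2} = {-1..1}" by simp
    show "\<exists>B. min_spans (strip (int m) {1 - 2..int 3 - 2}) B \<and> card B = (2 * m + 6) div 3"
      unfolding H using three_rows_construction assms by blast
    fix B assume "min_spans (strip (int m) {1 - 2..int 3 - 2}) B"
    then have "3 * int (card B) \<le> 2 * int m + 6"
      unfolding H using min_spans_three_rows_bound m by blast
    then show "card B \<le> (2 * m + 6) div 3" by linarith
  qed
  ultimately show ?thesis
    using floor[of 1] floor[of 2] floor[of 3] by simp
qed

end
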